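(* Let $R_1,R_2>0$, $R:=R_2/R_1$, and $t^-<t<t^+$. The height invariant of the coupled angular momenta system with parameters $R_1,R_2,t$ is $$\mathfrak{h}=2\min\{R_1,R_2\} + \frac{R_1}{\pi t} \left( r_A - 2R\,t \arctan \left( \frac{r_A}{R-t} \right)- 2\,t \arctan \left( \frac{r_A}{R+t-2R\,t} \right) \right),$$ where $r_A=\sqrt{-R^2(1-2t)^2+2Rt-t^2}$ and $\arctan$ denotes the determination taking values in $[0,\pi]$.
   Context: Coupled angular momenta. For $R_1,R_2>0$ let $M=\mathbb{S}^2\times\mathbb{S}^2$ with $\omega=-(R_1\omega_{\mathbb{S}^2}\oplus R_2\omega_{\mathbb{S}^2})$, $\omega_{\mathbb{S}^2}$ the standard area form of the unit sphere. With Cartesian coordinates $(x_i,y_i,z_i)$ on the $i$-th sphere and $t\in[0,1]$, the system is $(M,\omega,F=(L,H))$, $$L=R_1(z_1-1)+R_2(z_2+1),\qquad H=(1-t)z_1+t(x_1x_2+y_1y_2+z_1z_2)+2t-1 .$$ $t^\pm=\frac{R_2}{2R_2+R_1\mp2\sqrt{R_1R_2}}$; for $t^-<t<t^+$ there is exactly one focus-focus singularity $m=(0,0,1,0,0,-1)$, with $F(m)=(0,0)$. Height invariant. Let $Y=L^{-1}(L(m))$ and $Y^-=Y\cap\{p\in M: H(p)<H(m)\}$. The height invariant $\mathfrak{h}$ is the symplectic volume of $Y^-$, i.e. the area of the image of $Y^-$ in the symplectic quotient $Y/\mathbb{S}^1$ (by the $\mathbb{S}^1$-action generated by $L$) divided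 by $2\pi$. Equivalently, it is the vertical distance between the image of the focus-focus value and the lower boundary of the polygon in any representative of the semitoric polygon invariant. The total symplectic volume of the reduced space at level $L=0$ is $2\min\{R_1,R_2\}$. *)

theory Defs
  imports "HOL-Analysis.Analysis"
begin

section \<open>The product of two spheres and its symplectic form\<close>

type_synonym pt = "(real ^ 3) \<times> (real ^ 3)"

definition S2xS2 :: "pt set" where
  "S2xS2 = sphere 0 1 \<times> sphere 0 1"

definition tangent :: "pt \<Rightarrow> pt set" where
  "tangent p = {v. fst p \<bullet> fst v = 0 \<and> snd p \<bullet> snd v = 0}"

definition sphere_form :: "real ^ 3 \<Rightarrow> real ^ 3 \<Rightarrow> real ^ 3 \<Rightarrow> real" where
  "sphere_form n u v = n \<bullet> cross3 u v"

type_synonym two_form = "pt \<Rightarrow> pt \<Rightarrow> pt \<Rightarrow> real"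

definition cam_form :: "real \<Rightarrow> real \<Rightarrow> two_form" where
  "cam_form R1 R2 p u v =
     - (R1 * sphere_form (fst p) (fst u) (fst v) + R2 * sphere_form (snd p) (snd u) (snd v))"


section \<open>Hamiltonian flow, symplectic quotient and height invariant\<close>

text \<open>
  Functions on the product of spheres are given by differentiable functions on the ambient space;
  the differential of the restriction is the restriction of the differential.
  The opposite sign convention for Hamiltonian vector fields reverses the curves below and
  leaves the orbits unchanged.
\<close>

definition hamiltonian_curve :: "two_form \<Rightarrow> (pt \<Rightarrow> real) \<Rightarrow> (real \<Rightarrow> pt) \<Rightarrow> bool" where
  "hamiltonian_curve w f \<gamma> \<longleftrightarrow>
     (\<forall>s. \<gamma> s \<in> S2xS2 \<and>
        (\<exists>X \<in> tangent (\<gamma> s). (\<gamma> has_vector_derivative X) (at s) \<and>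
           (\<forall>v \<in> tangent (\<gamma> s). w (\<gamma> s) X v = frechet_derivative f (at (\<gamma> s)) v)))"

definition flow_orbit :: "two_form \<Rightarrow> (pt \<Rightarrow> real) \<Rightarrow> pt \<Rightarrow> pt set" where
  "flow_orbit w f p = {\<gamma> s | \<gamma> s. hamiltonian_curve w f \<gamma> \<and> \<gamma> 0 = p}"

definition level :: "(pt \<Rightarrow> real) \<Rightarrow> real \<Rightarrow> pt set" where
  "level f c = {p \<in> S2xS2. f p = c}"

text \<open>
  Points of the symplectic quotient of a level set are the orbits of the flow in it.
  A local parametrization of the quotient is given by a \<open>C\<^sup>1\<close> lift \<open>\<sigma>\<close> to the level set, defined
  on an open subset \<open>D\<close> of the plane and meeting each orbit at most once.
  Since the pullback of the reduced form to the level set is the restriction of \<open>w\<close>,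
  the reduced form reads \<open>\<sigma>\<^sup>*w\<close> in this parametrization.
\<close>

definition quotient_param ::
  "two_form \<Rightarrow> (pt \<Rightarrow> real) \<Rightarrow> real \<Rightarrow> (real ^ 2) set \<Rightarrow> (real ^ 2 \<Rightarrow> pt) \<Rightarrow> bool" where
  "quotient_param w f c D \<sigma> \<longleftrightarrow>
     open D \<and>
     (\<forall>d \<in> D. \<sigma> differentiable (at d)) \<and>
     (\<forall>v. continuous_on D (\<lambda>d. frechet_derivative \<sigma> (at d) v)) \<and>
     \<sigma> ` D \<subseteq> level f c \<and>
     inj_on (\<lambda>d. flow_orbit w f (\<sigma> d)) D"

definition param_area :: "two_form \<Rightarrow> (real ^ 2) set \<Rightarrow> (real ^ 2 \<Rightarrow> pt) \<Rightarrow> ennreal" where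
  "param_area w D \<sigma> =
     (\<integral>\<^sup>+ d \<in> D. ennreal \<bar>w (\<sigma> d) (frechet_derivative \<sigma> (at d) (axis 1 1))
                              (frechet_derivative \<sigma> (at d) (axis 2 1))\<bar> \<partial>lborel)"

text \<open>
  Area, with respect to the reduced form, of an open set \<open>A\<close> of orbits. As \<open>D\<close> need not be connected,
  a single \<open>\<sigma>\<close> can comprise any finite family of disjoint parametrized pieces, so the supremum
  exhausts \<open>A\<close> up to null sets; injectivity on orbits prevents overcounting.
\<close>

definition reduced_area :: "two_form \<Rightarrow> (pt \<Rightarrow> real) \<Rightarrow> real \<Rightarrow> pt set set \<Rightarrow> ennreal" where
  "reduced_area w f c A =
     (SUP (D, \<sigma>) \<in> {(D, \<sigma>). quotient_param w f c D \<sigma> \<and> (\<forall>d \<in> D. flow_orbit w f (\<sigma> d) \<in> A)}.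
        param_area w D \<sigma>)"

definition height_invariant ::
  "two_form \<Rightarrow> (pt \<Rightarrow> real) \<Rightarrow> (pt \<Rightarrow> real) \<Rightarrow> pt \<Rightarrow> real" where
  "height_invariant w L H m =
     enn2real (reduced_area w L (L m) (flow_orbit w L ` {p \<in> level L (L m). H p < H m})) / (2 * pi)"


section \<open>Coupled angular momenta\<close>

definition cam_L :: "real \<Rightarrow> real \<Rightarrow> pt \<Rightarrow> real" where
  "cam_L R1 R2 p = R1 * (fst p $ 3 - 1) + R2 * (snd p $ 3 + 1)"

definition cam_H :: "real \<Rightarrow> pt \<Rightarrow> real" where
  "cam_H t p = (1 - t) * fst p $ 3
     + t * (fst p $ 1 * snd p $ 1 + fst p $ 2 * snd p $ 2 + fst p $ 3 * snd p $ 3) + 2 * t - 1"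

definition cam_ff :: pt where
  "cam_ff = (vector [0, 0, 1], vector [0, 0, - 1])"

definition t_plus :: "real \<Rightarrow> real \<Rightarrow> real" where
  "t_plus R1 R2 = R2 / (2 * R2 + R1 - 2 * sqrt (R1 * R2))"

definition t_minus :: "real \<Rightarrow> real \<Rightarrow> real" where
  "t_minus R1 R2 = R2 / (2 * R2 + R1 + 2 * sqrt (R1 * R2))"

definition r_A :: "real \<Rightarrow> real \<Rightarrow> real" where
  "r_A R t = sqrt (- R\<^sup>2 * (1 - 2 * t)\<^sup>2 + 2 * R * t - t\<^sup>2)"

text \<open>
  The determination of \<open>arctan (y / x)\<close> with values in \<open>[0, \<pi>]\<close>. For \<open>y > 0\<close> and \<open>x = 0\<close> the quotient
  is infinite and the value is \<open>\<pi> / 2\<close>, whereas the totalised division would give \<open>0\<close>.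
\<close>

definition arctan_quot :: "real \<Rightarrow> real \<Rightarrow> real" where
  "arctan_quot y x =
     (if x = 0 then pi / 2
      else if arctan (y / x) < 0 then arctan (y / x) + pi
      else arctan (y / x))"

end

theory Submission
  imports Defs
begin

text \<open>
  The flow of \<open>L\<close> rotates both spheres about their vertical axes by the same angle, so its orbits in
  \<open>Y = {L = 0}\<close> are described by the depth \<open>s = 1 - z\<^sub>1\<close>, which ranges over \<open>[0, 2 min {1, R}]\<close> and
  determines \<open>z\<^sub>2 = s / R - 1\<close>, and by the angle \<open>\<theta>\<close> from the horizontal part of the first vector to that of
  the second. In these coordinates the reduced form is \<open>\<plusminus> R\<^sub>1 ds \<and> d\<theta>\<close>. The point of the plane with polar
  coordinates \<open>(\<surd>s, \<theta>)\<close> is an equally good coordinate on the quotient, without a cut along a ray; it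
  misses at most two orbits, those at the ends of the range of \<open>s\<close>, and turns the reduced form into
  \<open>2 R\<^sub>1\<close> times the Euclidean area form (\<open>reduced_form\<close>).

  Hence the area swept out by any parametrization of the quotient is \<open>2 R\<^sub>1\<close> times the Lebesgue
  measure of its image in the plane, by the change of variables formula. It is at most
  \<open>2 R\<^sub>1\<close> times the measure of the region where \<open>H < 0\<close>, and an explicit section of the quotient over
  that region attains this bound (\<open>reduced_area_eq\<close>).

  In polar coordinates \<open>H\<close> is affine in \<open>cos \<theta>\<close>, so for each \<open>s\<close> the condition \<open>H < 0\<close> reads
  \<open>C s < \<bar>\<theta>\<bar>\<close>, and the region has measure \<open>\<integral> (\<pi> - C s) ds\<close>. With
  \<open>\<omega> = r\<^sub>A\<^sup>2 - 2 R t (1 - t) s\<close>, \<open>A = R - t\<close> and \<open>B = R + t - 2 R t\<close>, the condition becomes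
  \<open>\<surd>((A\<^sup>2 + \<omega>) (B\<^sup>2 + \<omega>)) cos \<theta> < A B - \<omega>\<close>. For \<open>\<omega> > 0\<close> its right-hand side is the real part of
  \<open>(A + i \<surd>\<omega>) (B + i \<surd>\<omega>)\<close> and the root is the modulus of that product, so
  \<open>C s = arg (A + i \<surd>\<omega>) + arg (B + i \<surd>\<omega>)\<close>; for \<open>\<omega> \<le> 0\<close> the whole circle, or nothing, lies below the level,
  which is the same formula with \<open>\<surd>\<omega>\<close> replaced by \<open>0\<close>. The integral is then elementary, since
  \<open>(A\<^sup>2 + x\<^sup>2) arg (A + i x) - A x\<close> is a primitive of \<open>2 x arg (A + i x)\<close>; its boundary term at \<open>x = 0\<close>
  cancels the contribution of \<open>\<omega> \<le> 0\<close>, and the value at \<open>x = r\<^sub>A\<close> gives the two arctangents.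
\<close>

section \<open>The circle action generated by the total momentum\<close>

lemma inner_3: "(u::real^3) \<bullet> v = u$1 * v$1 + u$2 * v$2 + u$3 * v$3"
  by (simp add: inner_vec_def sum_3)

lemma vec3_eqI: "u $ 1 = v $ 1 \<Longrightarrow> u $ 2 = v $ 2 \<Longrightarrow> u $ 3 = v $ 3 \<Longrightarrow> u = (v :: real^3)"
  by (simp add: vec_eq_iff forall_3)

lemma mem_S2xS2: "p \<in> S2xS2 \<longleftrightarrow> fst p \<bullet> fst p = 1 \<and> snd p \<bullet> snd p = 1"
  by (cases p) (simp add: S2xS2_def norm_eq_1)

lemma cam_L_has_derivative:
  "(cam_L R1 R2 has_derivative (\<lambda>v. R1 * fst v $ 3 + R2 * snd v $ 3)) (at p)"
proof -
  have "bounded_linear (\<lambda>p::pt. fst p $ 3)" "bounded_linear (\<lambda>p::pt. snd p $ 3)"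
    using bounded_linear_compose[OF bounded_linear_vec_nth bounded_linear_fst]
      bounded_linear_compose[OF bounded_linear_vec_nth bounded_linear_snd] by auto
  note [derivative_intros] = this[THEN bounded_linear_imp_has_derivative]
  show ?thesis
    unfolding cam_L_def by (auto intro!: derivative_eq_intros simp: algebra_simps)
qed

lemma frechet_cam_L: "frechet_derivative (cam_L R1 R2) (at p) v = R1 * fst v $ 3 + R2 * snd v $ 3"
  by (simp add: frechet_derivative_at[OF cam_L_has_derivative, symmetric])

text \<open>The value \<open>n \<times> e\<^sub>3\<close> at \<open>n\<close> of the velocity field of the clockwise rotation about the vertical axis.\<close>

definition spin :: "real^3 \<Rightarrow> real^3" where
  "spin n = vector [n $ 2, - n $ 1, 0]"

lemma sphere_form_spin:
  assumes "n \<bullet> v = 0"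
  shows "sphere_form n (spin n) v = - (n \<bullet> n) * v $ 3"
proof -
  have e: "n$1 * v$1 + n$2 * v$2 = - (n$3 * v$3)"
    using assms by (simp add: inner_3)
  have "sphere_form n (spin n) v
      = n$3 * (n$1 * v$1 + n$2 * v$2) - (n$1 * n$1 + n$2 * n$2) * v$3"
    by (simp add: sphere_form_def spin_def cross3_def inner_3 algebra_simps)
  also have "\<dots> = - (n \<bullet> n) * v $ 3"
    unfolding e by (simp add: inner_3 algebra_simps)
  finally show ?thesis .
qed

lemma sphere_form_zero [simp]: "sphere_form n u 0 = 0"
  by (simp add: sphere_form_def cross3_def inner_3)

text \<open>
  Every tangent vector at \<open>n\<close> has the form \<open>n \<times> b\<close>, and for unit \<open>n\<close> and tangent \<open>X\<close> the area form
  of \<open>X\<close> and \<open>n \<times> b\<close> is \<open>X \<bullet> b\<close>; so the form determines all components of \<open>X\<close>.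
\<close>

lemma spin_unique:
  assumes n: "n \<bullet> n = 1" and X: "n \<bullet> X = 0"
    and form: "\<And>v. n \<bullet> v = 0 \<Longrightarrow> sphere_form n X v = - v $ 3"
  shows "X = spin n"
proof -
  have key: "X \<bullet> b = - (cross3 n b) $ 3" for b
  proof -
    have "sphere_form n X (cross3 n b) = (n \<bullet> n) * (X \<bullet> b) - (n \<bullet> X) * (n \<bullet> b)"
      by (simp add: sphere_form_def cross3_def inner_3 algebra_simps)
    moreover have "n \<bullet> cross3 n b = 0"
      by (simp add: cross3_def inner_3 algebra_simps)
    ultimately show ?thesis using form[of "cross3 n b"] n X by simp
  qed
  show ?thesis
    using key[of "axis 1 1"] key[of "axis 2 1"] key[of "axis 3 1"]
    by (intro vec3_eqI) (simp_all add: inner_axis spin_def cross3_def, simp_all add: axis_def)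
qed

text \<open>
  The weights \<open>R1\<close> and \<open>R2\<close> occur both in the form and in \<open>L\<close> and cancel, which is why both spheres
  turn at the same speed. Test vectors that vanish in one factor separate the two spheres.
\<close>

lemma cam_hamiltonian_vector_field:
  assumes R: "R1 > 0" "R2 > 0" and p: "p \<in> S2xS2" and X: "X \<in> tangent p"
  shows "(\<forall>v \<in> tangent p. cam_form R1 R2 p X v = frechet_derivative (cam_L R1 R2) (at p) v)
         \<longleftrightarrow> X = (spin (fst p), spin (snd p))"
proof
  assume *: "\<forall>v \<in> tangent p. cam_form R1 R2 p X v = frechet_derivative (cam_L R1 R2) (at p) v"
  have "fst X = spin (fst p)"
  proof (rule spin_unique)
    fix v assume "fst p \<bullet> v = 0"
    then have "(v, 0) \<in> tangent p" by (simp add: tangent_def)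
    with * have "cam_form R1 R2 p X (v, 0) = R1 * v $ 3" by (auto simp: frechet_cam_L)
    then have "R1 * sphere_form (fst p) (fst X) v = R1 * (- v $ 3)" by (simp add: cam_form_def)
    then show "sphere_form (fst p) (fst X) v = - v $ 3"
      using R by (metis mult_left_cancel less_irrefl)
  qed (use p X in \<open>auto simp: mem_S2xS2 tangent_def\<close>)
  moreover have "snd X = spin (snd p)"
  proof (rule spin_unique)
    fix v assume "snd p \<bullet> v = 0"
    then have "(0, v) \<in> tangent p" by (simp add: tangent_def)
    with * have "cam_form R1 R2 p X (0, v) = R2 * v $ 3" by (auto simp: frechet_cam_L)
    then have "R2 * sphere_form (snd p) (snd X) v = R2 * (- v $ 3)" by (simp add: cam_form_def)
    then show "sphere_form (snd p) (snd X) v = - v $ 3"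
      using R by (metis mult_left_cancel less_irrefl)
  qed (use p X in \<open>auto simp: mem_S2xS2 tangent_def\<close>)
  ultimately show "X = (spin (fst p), spin (snd p))" by (simp add: prod_eq_iff)
next
  assume "X = (spin (fst p), spin (snd p))"
  then show "\<forall>v \<in> tangent p. cam_form R1 R2 p X v = frechet_derivative (cam_L R1 R2) (at p) v"
    using p by (auto simp: cam_form_def sphere_form_spin frechet_cam_L tangent_def mem_S2xS2)
qed

definition rot :: "real \<Rightarrow> real^3 \<Rightarrow> real^3" where
  "rot a v = vector [cos a * v$1 - sin a * v$2, sin a * v$1 + cos a * v$2, v$3]"

definition rot2 :: "real \<Rightarrow> pt \<Rightarrow> pt" where
  "rot2 a p = (rot a (fst p), rot a (snd p))"

lemma rot_0 [simp]: "rot 0 v = v"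
  by (rule vec3_eqI) (simp_all add: rot_def)

lemma rot_rot: "rot a (rot b v) = rot (a + b) v"
  by (rule vec3_eqI) (simp_all add: rot_def cos_add sin_add algebra_simps)

lemma rot2_rot2: "rot2 a (rot2 b p) = rot2 (a + b) p"
  by (simp add: rot2_def rot_rot)

lemma rot2_0 [simp]: "rot2 0 p = p"
  by (simp add: rot2_def)

lemma inner_rot: "rot a u \<bullet> rot a v = u \<bullet> v"
proof -
  have "(c * x - s * y) * (c * x' - s * y') + (s * x + c * y) * (s * x' + c * y')
      = (c\<^sup>2 + s\<^sup>2) * (x * x' + y * y')" for c s x y x' y' :: real
    by (simp add: algebra_simps power2_eq_square)
  then show ?thesis by (simp add: rot_def inner_3)
qed

lemma rot2_mem [simp]: "rot2 a p \<in> S2xS2 \<longleftrightarrow> p \<in> S2xS2"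
  by (simp add: mem_S2xS2 rot2_def inner_rot)

lemma vec3_has_vector_derivativeI:
  fixes f :: "real \<Rightarrow> real^3"
  assumes "((\<lambda>s. f s $ 1) has_real_derivative f' $ 1) F"
    "((\<lambda>s. f s $ 2) has_real_derivative f' $ 2) F"
    "((\<lambda>s. f s $ 3) has_real_derivative f' $ 3) F"
  shows "(f has_vector_derivative f') F"
proof -
  have "((\<lambda>s. (f s $ 1) *\<^sub>R axis 1 1 + (f s $ 2) *\<^sub>R axis 2 1 + (f s $ 3) *\<^sub>R axis 3 (1::real))
      has_vector_derivative
      ((f' $ 1) *\<^sub>R axis 1 1 + (f' $ 2) *\<^sub>R axis 2 1 + (f' $ 3) *\<^sub>R axis 3 1 :: real^3)) F"
    using assms unfolding has_real_derivative_iff_has_vector_derivative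
    by (intro has_vector_derivative_add bounded_linear.has_vector_derivative[OF bounded_linear_scaleR_left])
  moreover have "(v $ 1) *\<^sub>R axis 1 1 + (v $ 2) *\<^sub>R axis 2 1 + (v $ 3) *\<^sub>R axis 3 (1::real) = v" for v :: "real^3"
    by (rule vec3_eqI) (simp_all add: axis_def)
  ultimately show ?thesis by simp
qed

lemma has_vector_derivative_nth:
  fixes f :: "real \<Rightarrow> real^3"
  assumes "(f has_vector_derivative f') F"
  shows "((\<lambda>s. f s $ i) has_real_derivative f' $ i) F"
  unfolding has_real_derivative_iff_has_vector_derivative
  by (rule bounded_linear.has_vector_derivative[OF bounded_linear_vec_nth assms])

lemma rot_has_vector_derivative:
  "((\<lambda>s. rot (- s) n) has_vector_derivative spin (rot (- s) n)) (at s)"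
  by (rule vec3_has_vector_derivativeI)
     (auto intro!: derivative_eq_intros simp: rot_def spin_def)

text \<open>Seen from a frame rotating in the opposite sense, the curve is at rest.\<close>

lemma spin_curve_unique:
  fixes f :: "real \<Rightarrow> real^3"
  assumes "\<And>s. (f has_vector_derivative spin (f s)) (at s)"
  shows "f s = rot (- s) (f 0)"
proof -
  have nth: "((\<lambda>s. f s $ i) has_real_derivative spin (f s) $ i) (at s)" for i s
    by (rule has_vector_derivative_nth[OF assms])
  have "((\<lambda>s. f s $ 3) has_real_derivative 0) (at s)" for s
    using nth[of 3 s] by (simp add: spin_def)
  note third = this
  have "((\<lambda>s. rot s (f s)) has_vector_derivative 0) (at s)" for s
    by (rule vec3_has_vector_derivativeI)
       (auto intro!: derivative_eq_intros nth third simp: rot_def spin_def)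
  then obtain c where "\<And>s. rot s (f s) = c"
    using has_vector_derivative_zero_constant[of UNIV "\<lambda>s. rot s (f s)"] by auto
  then have "rot s (f s) = f 0" by (metis rot_0)
  then show ?thesis by (metis add.left_inverse rot_0 rot_rot)
qed

text \<open>Replaces the flow by rotations, after which orbits are a matter of plane geometry.\<close>

lemma flow_orbit_cam_L:
  assumes R: "R1 > 0" "R2 > 0" and p: "p \<in> S2xS2"
  shows "flow_orbit (cam_form R1 R2) (cam_L R1 R2) p = range (\<lambda>a. rot2 a p)"
proof (intro set_eqI iffI)
  fix q assume "q \<in> flow_orbit (cam_form R1 R2) (cam_L R1 R2) p"
  then obtain \<gamma> s where q: "q = \<gamma> s" and \<gamma>: "hamiltonian_curve (cam_form R1 R2) (cam_L R1 R2) \<gamma>"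
    and 0: "\<gamma> 0 = p" by (auto simp: flow_orbit_def)
  have D: "(\<gamma> has_vector_derivative (spin (fst (\<gamma> s)), spin (snd (\<gamma> s)))) (at s)" for s
    using \<gamma> cam_hamiltonian_vector_field[OF R] unfolding hamiltonian_curve_def by blast
  have "fst (\<gamma> s) = rot (- s) (fst (\<gamma> 0))" "snd (\<gamma> s) = rot (- s) (snd (\<gamma> 0))"
    using bounded_linear.has_vector_derivative[OF bounded_linear_fst D]
      bounded_linear.has_vector_derivative[OF bounded_linear_snd D]
    by (auto intro!: spin_curve_unique[of "\<lambda>s. fst (\<gamma> s)"] spin_curve_unique[of "\<lambda>s. snd (\<gamma> s)"])
  then have "q = rot2 (- s) p" by (simp add: q 0 rot2_def prod_eq_iff)
  then show "q \<in> range (\<lambda>a. rot2 a p)" by blast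
next
  fix q assume "q \<in> range (\<lambda>a. rot2 a p)"
  then obtain a where q: "q = rot2 a p" by blast
  define \<gamma> where "\<gamma> s = rot2 (- s) p" for s
  have mem: "\<gamma> s \<in> S2xS2" for s using p by (simp add: \<gamma>_def)
  have D: "(\<gamma> has_vector_derivative (spin (fst (\<gamma> s)), spin (snd (\<gamma> s)))) (at s)" for s
    unfolding \<gamma>_def rot2_def
    using has_vector_derivative_Pair[OF rot_has_vector_derivative rot_has_vector_derivative]
    by simp
  have T: "(spin (fst (\<gamma> s)), spin (snd (\<gamma> s))) \<in> tangent (\<gamma> s)" for s
    by (simp add: tangent_def spin_def inner_3)
  have "hamiltonian_curve (cam_form R1 R2) (cam_L R1 R2) \<gamma>"
    unfolding hamiltonian_curve_def
    using mem D T cam_hamiltonian_vector_field[OF R mem T] by blast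
  moreover have "\<gamma> 0 = p" "\<gamma> (- a) = q" by (simp_all add: \<gamma>_def q)
  ultimately show "q \<in> flow_orbit (cam_form R1 R2) (cam_L R1 R2) p"
    unfolding flow_orbit_def by blast
qed

text \<open>
  Real and imaginary part of \<open>cnj \<zeta>\<^sub>1 * \<zeta>\<^sub>2\<close>, where \<open>\<zeta>\<^sub>i = x\<^sub>i + i y\<^sub>i\<close>.
\<close>

definition inv_X :: "pt \<Rightarrow> real" where
  "inv_X p = fst p $ 1 * snd p $ 1 + fst p $ 2 * snd p $ 2"

definition inv_Y :: "pt \<Rightarrow> real" where
  "inv_Y p = fst p $ 1 * snd p $ 2 - fst p $ 2 * snd p $ 1"

lemma rot2_invariants:
  "inv_X (rot2 a p) = inv_X p" "inv_Y (rot2 a p) = inv_Y p"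
  "fst (rot2 a p) $ 3 = fst p $ 3" "snd (rot2 a p) $ 3 = snd p $ 3"
proof -
  have "(c * x - s * y) * (c * x' - s * y') + (s * x + c * y) * (s * x' + c * y')
      = (c\<^sup>2 + s\<^sup>2) * (x * x' + y * y')"
    "(c * x - s * y) * (s * x' + c * y') - (s * x + c * y) * (c * x' - s * y')
      = (c\<^sup>2 + s\<^sup>2) * (x * y' - y * x')" for c s x y x' y' :: real
    by (simp_all add: algebra_simps power2_eq_square)
  then show "inv_X (rot2 a p) = inv_X p" "inv_Y (rot2 a p) = inv_Y p"
    by (simp_all add: inv_X_def inv_Y_def rot2_def rot_def)
qed (simp_all add: rot2_def rot_def)

lemma plane_rotation_exists:
  fixes x y x' y' :: real
  assumes "x\<^sup>2 + y\<^sup>2 = x'\<^sup>2 + y'\<^sup>2" "x\<^sup>2 + y\<^sup>2 \<noteq> 0"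
  obtains a where "x' = cos a * x - sin a * y" "y' = sin a * x + cos a * y"
proof -
  let ?N = "x\<^sup>2 + y\<^sup>2"
  let ?c = "(x * x' + y * y') / ?N" and ?s = "(x * y' - y * x') / ?N"
  have "(x * x' + y * y')\<^sup>2 + (x * y' - y * x')\<^sup>2 = ?N * (x'\<^sup>2 + y'\<^sup>2)"
    by (simp add: power2_eq_square algebra_simps)
  then have "?c\<^sup>2 + ?s\<^sup>2 = 1"
    using assms by (simp add: power_divide add_divide_distrib[symmetric] power2_eq_square)
  then obtain a where "?c = cos a" "?s = sin a"
    using sincos_total_2pi by metis
  moreover have "(x * x' + y * y') * x - (x * y' - y * x') * y = ?N * x'"
    "(x * y' - y * x') * x + (x * x' + y * y') * y = ?N * y'"
    by (simp_all add: algebra_simps power2_eq_square)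
  then have "?c * x - ?s * y = x'" "?s * x + ?c * y = y'"
    using assms(2) by (simp_all only: times_divide_eq_left diff_divide_distrib[symmetric]
        add_divide_distrib[symmetric] nonzero_mult_div_cancel_left not_False_eq_True)
  ultimately show ?thesis using that[of a] by simp
qed

text \<open>
  The heights fix the moduli of \<open>\<zeta>\<^sub>1\<close> and \<open>\<zeta>\<^sub>2\<close>. If \<open>\<zeta>\<^sub>1 \<noteq> 0\<close>, a rotation matches the first vectors,
  and then \<open>cnj \<zeta>\<^sub>1 * \<zeta>\<^sub>2\<close> fixes the second one. If \<open>\<zeta>\<^sub>1 = 0\<close>, the first vector is a pole and the rotation
  may be chosen for the second vector alone.
\<close>

lemma same_invariants_imp_rot2:
  assumes p: "p \<in> S2xS2" and p': "p' \<in> S2xS2"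
    and z: "fst p $ 3 = fst p' $ 3" "snd p $ 3 = snd p' $ 3"
    and X: "inv_X p = inv_X p'" and Y: "inv_Y p = inv_Y p'"
  obtains a where "p' = rot2 a p"
proof -
  let ?n1 = "fst p" and ?n2 = "snd p" and ?m1 = "fst p'" and ?m2 = "snd p'"
  have N1: "(?n1$1)\<^sup>2 + (?n1$2)\<^sup>2 = (?m1$1)\<^sup>2 + (?m1$2)\<^sup>2"
    and N2: "(?n2$1)\<^sup>2 + (?n2$2)\<^sup>2 = (?m2$1)\<^sup>2 + (?m2$2)\<^sup>2"
    using p p' z by (auto simp: mem_S2xS2 inner_3 power2_eq_square)
  show ?thesis
  proof (cases "(?n1$1)\<^sup>2 + (?n1$2)\<^sup>2 = 0")
    case False
    then obtain a where a: "?m1$1 = cos a * ?n1$1 - sin a * ?n1$2" "?m1$2 = sin a * ?n1$1 + cos a * ?n1$2"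
      using plane_rotation_exists[OF N1] by metis
    \<comment> \<open>It remains to identify \<open>q\<close>, which shares its first vector with \<open>p\<close>, with \<open>p\<close>.\<close>
    define q where "q = rot2 (-a) p'"
    have "?m1 = rot a ?n1" by (rule vec3_eqI) (simp_all add: a rot_def z)
    then have q1: "fst q = ?n1" by (simp add: q_def rot2_def rot_rot)
    have "inv_X q = inv_X p" "inv_Y q = inv_Y p" by (simp_all add: q_def rot2_invariants X Y)
    then have e: "?n1$1 * (snd q$1 - ?n2$1) + ?n1$2 * (snd q$2 - ?n2$2) = 0"
      "?n1$1 * (snd q$2 - ?n2$2) - ?n1$2 * (snd q$1 - ?n2$1) = 0"
      unfolding inv_X_def inv_Y_def q1 by (simp_all add: algebra_simps)
    have "((?n1$1)\<^sup>2 + (?n1$2)\<^sup>2) * (snd q$1 - ?n2$1) =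
        ?n1$1 * (?n1$1 * (snd q$1 - ?n2$1) + ?n1$2 * (snd q$2 - ?n2$2))
        - ?n1$2 * (?n1$1 * (snd q$2 - ?n2$2) - ?n1$2 * (snd q$1 - ?n2$1))"
      "((?n1$1)\<^sup>2 + (?n1$2)\<^sup>2) * (snd q$2 - ?n2$2) =
        ?n1$2 * (?n1$1 * (snd q$1 - ?n2$1) + ?n1$2 * (snd q$2 - ?n2$2))
        + ?n1$1 * (?n1$1 * (snd q$2 - ?n2$2) - ?n1$2 * (snd q$1 - ?n2$1))"
      by (simp_all add: algebra_simps power2_eq_square)
    then have "snd q $ 1 = ?n2 $ 1" "snd q $ 2 = ?n2 $ 2"
      unfolding e using False by (simp_all only: mult_zero_right diff_zero add_0_right mult_eq_0_iff right_minus_eq simp_thms)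
    moreover have "snd q $ 3 = ?n2 $ 3" by (simp add: q_def rot2_invariants z)
    ultimately have "q = p" using q1 by (simp add: prod_eq_iff vec3_eqI)
    then have "p' = rot2 a p" by (auto simp: q_def rot2_rot2)
    then show ?thesis by (rule that)
  next
    case n1: True
    then have 0: "?n1$1 = 0" "?n1$2 = 0" "?m1$1 = 0" "?m1$2 = 0"
      using N1 by (simp_all add: sum_power2_eq_zero_iff)
    show ?thesis
    proof (cases "(?n2$1)\<^sup>2 + (?n2$2)\<^sup>2 = 0")
      case False
      then obtain a where a: "?m2$1 = cos a * ?n2$1 - sin a * ?n2$2" "?m2$2 = sin a * ?n2$1 + cos a * ?n2$2"
        using plane_rotation_exists[OF N2] by metis
      have "p' = rot2 a p"
        unfolding prod_eq_iff rot2_def fst_conv snd_conv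
        by (intro conjI vec3_eqI) (simp_all add: rot_def 0 z a)
      then show ?thesis by (rule that)
    next
      case True
      then have "?n2$1 = 0" "?n2$2 = 0" "?m2$1 = 0" "?m2$2 = 0"
        using N2 by (simp_all add: sum_power2_eq_zero_iff)
      then have "p' = rot2 0 p"
        using 0 z by (simp add: prod_eq_iff vec3_eqI)
      then show ?thesis by (rule that)
    qed
  qed
qed

lemma flow_orbit_eq_iff:
  assumes R: "R1 > 0" "R2 > 0" and p: "p \<in> S2xS2" and p': "p' \<in> S2xS2"
  shows "flow_orbit (cam_form R1 R2) (cam_L R1 R2) p = flow_orbit (cam_form R1 R2) (cam_L R1 R2) p'
    \<longleftrightarrow> fst p $ 3 = fst p' $ 3 \<and> snd p $ 3 = snd p' $ 3 \<and> inv_X p = inv_X p' \<and> inv_Y p = inv_Y p'"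
    (is "_ \<longleftrightarrow> ?inv")
proof -
  have "range (\<lambda>a. rot2 a p) = range (\<lambda>a. rot2 a p') \<longleftrightarrow> ?inv"
  proof
    assume "range (\<lambda>a. rot2 a p) = range (\<lambda>a. rot2 a p')"
    then have "rot2 0 p \<in> range (\<lambda>a. rot2 a p')" by blast
    then obtain a where "p = rot2 a p'" by auto
    then show ?inv by (simp add: rot2_invariants)
  next
    assume ?inv
    then obtain a where a: "p' = rot2 a p"
      using same_invariants_imp_rot2[OF p p'] by metis
    have "rot2 b p = rot2 (b - a) p'" "rot2 b p' = rot2 (b + a) p" for b
      by (simp_all add: a rot2_rot2)
    then have "rot2 b p \<in> range (\<lambda>a. rot2 a p')" "rot2 b p' \<in> range (\<lambda>a. rot2 a p)" for b
      by (metis rangeI)+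
    then show "range (\<lambda>a. rot2 a p) = range (\<lambda>a. rot2 a p')" by blast
  qed
  then show ?thesis by (simp add: flow_orbit_cam_L[OF R] p p')
qed

section \<open>An equi-areal coordinate on the quotient\<close>

lemma has_derivative_vector_2 [derivative_intros]:
  fixes f g :: "'a::real_normed_vector \<Rightarrow> real"
  assumes "(f has_derivative f') F" "(g has_derivative g') F"
  shows "((\<lambda>x. vector [f x, g x] :: real^2) has_derivative (\<lambda>v. vector [f' v, g' v])) F"
proof -
  have v: "(vector [a, b] :: real^2) = a *\<^sub>R axis 1 1 + b *\<^sub>R axis 2 1" for a b
    by (simp add: vec_eq_iff forall_2 axis_def)
  show ?thesis unfolding v using assms by (intro derivative_intros)
qed

lemma vector_3_axis: "(vector [a, b, c] :: real^3) = a *\<^sub>R axis 1 1 + b *\<^sub>R axis 2 1 + c *\<^sub>R axis 3 1"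
  by (rule vec3_eqI) (simp_all add: axis_def)

lemma has_derivative_vector_3 [derivative_intros]:
  fixes f g h :: "'a::real_normed_vector \<Rightarrow> real"
  assumes "(f has_derivative f') F" "(g has_derivative g') F" "(h has_derivative h') F"
  shows "((\<lambda>x. vector [f x, g x, h x] :: real^3) has_derivative (\<lambda>v. vector [f' v, g' v, h' v])) F"
  unfolding vector_3_axis using assms by (intro derivative_intros)

lemma continuous_on_vector_3 [continuous_intros]:
  fixes f g h :: "'a::topological_space \<Rightarrow> real"
  assumes "continuous_on S f" "continuous_on S g" "continuous_on S h"
  shows "continuous_on S (\<lambda>x. vector [f x, g x, h x] :: real^3)"
  unfolding vector_3_axis using assms by (intro continuous_intros)

text \<open>
  The area form of the sphere in cylindrical coordinates, \<open>d\<phi> \<and> dz\<close>. Multiplying by the squared distance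
  from the axis replaces \<open>d\<phi>\<close> by \<open>x dy - y dx\<close> and extends the identity to the poles.
\<close>

lemma sphere_form_angle_height:
  assumes n: "n \<bullet> n = 1" and a: "n \<bullet> a = 0" and b: "n \<bullet> b = 0"
  shows "((n$1)\<^sup>2 + (n$2)\<^sup>2) * sphere_form n a b
    = (n$1 * a$2 - n$2 * a$1) * b$3 - (n$1 * b$2 - n$2 * b$1) * a$3"
proof -
  let ?x = "n$1" and ?y = "n$2" and ?z = "n$3"
  let ?S = "(?x * a$2 - ?y * a$1) * b$3 - (?x * b$2 - ?y * b$1) * a$3"
  have a3: "?z * a$3 = - (?x * a$1 + ?y * a$2)" and b3: "?z * b$3 = - (?x * b$1 + ?y * b$2)"
    using a b by (simp_all add: inner_3)
  have N: "?x\<^sup>2 + ?y\<^sup>2 = 1 - ?z\<^sup>2"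
    using n by (simp add: inner_3 power2_eq_square)
  \<comment> \<open>Tangency turns \<open>z\<close> times a vertical component into horizontal ones.\<close>
  have "?z * ?S = (?x * a$2 - ?y * a$1) * (?z * b$3) - (?x * b$2 - ?y * b$1) * (?z * a$3)"
    by (simp add: algebra_simps)
  also have "\<dots> = (?x\<^sup>2 + ?y\<^sup>2) * (a$1 * b$2 - a$2 * b$1)"
    unfolding a3 b3 by (simp add: algebra_simps power2_eq_square)
  finally have zS: "(?x\<^sup>2 + ?y\<^sup>2) * (a$1 * b$2 - a$2 * b$1) = ?z * ?S" by simp
  have sf: "sphere_form n a b = ?S + ?z * (a$1 * b$2 - a$2 * b$1)"
    by (simp add: sphere_form_def cross3_def inner_3 algebra_simps)
  have "(?x\<^sup>2 + ?y\<^sup>2) * sphere_form n a b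
      = (?x\<^sup>2 + ?y\<^sup>2) * ?S + ?z * ((?x\<^sup>2 + ?y\<^sup>2) * (a$1 * b$2 - a$2 * b$1))"
    unfolding sf by (simp add: algebra_simps)
  also have "\<dots> = ?S" unfolding zS unfolding N by (simp add: algebra_simps power2_eq_square)
  finally show ?thesis .
qed

definition d_inv_X :: "pt \<Rightarrow> pt \<Rightarrow> real" where
  "d_inv_X p v = fst v $ 1 * snd p $ 1 + fst p $ 1 * snd v $ 1
    + (fst v $ 2 * snd p $ 2 + fst p $ 2 * snd v $ 2)"

definition d_inv_Y :: "pt \<Rightarrow> pt \<Rightarrow> real" where
  "d_inv_Y p v = fst v $ 1 * snd p $ 2 + fst p $ 1 * snd v $ 2
    - (fst v $ 2 * snd p $ 1 + fst p $ 2 * snd v $ 1)"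

lemma has_derivative_nth_fst:
  assumes "(\<sigma> has_derivative \<sigma>') F"
  shows "((\<lambda>d. fst (\<sigma> d) $ i) has_derivative (\<lambda>v. fst (\<sigma>' v) $ i)) F"
  by (rule bounded_linear.has_derivative[OF bounded_linear_compose[OF bounded_linear_vec_nth bounded_linear_fst] assms])

lemma has_derivative_nth_snd:
  assumes "(\<sigma> has_derivative \<sigma>') F"
  shows "((\<lambda>d. snd (\<sigma> d) $ i) has_derivative (\<lambda>v. snd (\<sigma>' v) $ i)) F"
  by (rule bounded_linear.has_derivative[OF bounded_linear_compose[OF bounded_linear_vec_nth bounded_linear_snd] assms])

lemma inv_X_has_derivative:
  assumes "(\<sigma> has_derivative \<sigma>') (at d)"
  shows "((\<lambda>d. inv_X (\<sigma> d)) has_derivative (\<lambda>v. d_inv_X (\<sigma> d) (\<sigma>' v))) (at d)"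
  unfolding inv_X_def d_inv_X_def
  by (rule derivative_eq_intros has_derivative_nth_fst[OF assms] has_derivative_nth_snd[OF assms] refl)+
     (simp add: fun_eq_iff)

lemma inv_Y_has_derivative:
  assumes "(\<sigma> has_derivative \<sigma>') (at d)"
  shows "((\<lambda>d. inv_Y (\<sigma> d)) has_derivative (\<lambda>v. d_inv_Y (\<sigma> d) (\<sigma>' v))) (at d)"
  unfolding inv_Y_def d_inv_Y_def
  by (rule derivative_eq_intros has_derivative_nth_fst[OF assms] has_derivative_nth_snd[OF assms] refl)+
     (simp add: fun_eq_iff)

text \<open>Differentiates the equations that define the level set along a parametrization.\<close>

lemma has_derivative_locally_constant:
  assumes "(f has_derivative f') (at d)" "open D" "d \<in> D" "\<And>x. x \<in> D \<Longrightarrow> f x = c"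
  shows "f' = (\<lambda>_. 0)"
proof -
  have "(f has_derivative (\<lambda>_. 0)) (at d)"
    by (rule has_derivative_transform_within_open[OF has_derivative_const[of c] assms(2,3)]) (simp add: assms(4))
  then show ?thesis using assms(1) has_derivative_unique by blast
qed

locale cam_params =
  fixes R1 R2 :: real
  assumes R1: "R1 > 0" and R2: "R2 > 0"
begin

abbreviation w :: two_form where "w \<equiv> cam_form R1 R2"
abbreviation L :: "pt \<Rightarrow> real" where "L \<equiv> cam_L R1 R2"

definition R :: real where "R = R2 / R1"

lemma R: "R > 0" using R1 R2 by (simp add: R_def)

definition depth :: "pt \<Rightarrow> real" where "depth p = 1 - fst p $ 3"

text \<open>
  The invariant \<open>cnj \<zeta>\<^sub>1 * \<zeta>\<^sub>2\<close> has modulus \<open>s \<surd>((2 - s) (2 R - s)) / R\<close> at depth \<open>s\<close>; this factor brings it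
  to \<open>\<surd>s\<close>, the radius for which polar coordinates take \<open>ds \<and> d\<theta>\<close> to twice the Euclidean area form.
\<close>

definition scale :: "real \<Rightarrow> real" where "scale s = R / sqrt (s * (2 - s) * (2 * R - s))"

definition quot_coord :: "pt \<Rightarrow> real^2" where "quot_coord p = vector [scale (depth p) * inv_X p, scale (depth p) * inv_Y p]"

text \<open>The depth ranges over \<open>[0, 2 * half_depth]\<close>; at the far end the first vector points south or the second one north.\<close>

definition half_depth :: real where "half_depth = min 1 R"

lemma fst_3: "fst p $ 3 = 1 - depth p" by (simp add: depth_def)

lemma snd_3:
  assumes "p \<in> level L 0"
  shows "snd p $ 3 = depth p / R - 1"
  using assms R1 R2 by (simp add: level_def cam_L_def depth_def R_def field_simps)

lemma level_mem: "p \<in> level L 0 \<Longrightarrow> p \<in> S2xS2"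
  by (simp add: level_def)

lemma radius_1:
  assumes "p \<in> level L 0"
  shows "(fst p $ 1)\<^sup>2 + (fst p $ 2)\<^sup>2 = depth p * (2 - depth p)"
  using level_mem[OF assms] by (simp add: mem_S2xS2 inner_3 fst_3 power2_eq_square algebra_simps)

lemma radius_2:
  assumes "p \<in> level L 0"
  shows "(snd p $ 1)\<^sup>2 + (snd p $ 2)\<^sup>2 = depth p * (2 * R - depth p) / R\<^sup>2"
proof -
  have "(snd p $ 1)\<^sup>2 + (snd p $ 2)\<^sup>2 = 1 - (depth p / R - 1)\<^sup>2"
    using level_mem[OF assms] by (simp add: mem_S2xS2 inner_3 snd_3[OF assms] power2_eq_square algebra_simps)
  also have "\<dots> = depth p * (2 * R - depth p) / R\<^sup>2"
    using R by (simp add: field_simps power2_eq_square)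
  finally show ?thesis .
qed

lemma inv_X_Y_radius:
  assumes "p \<in> level L 0"
  shows "(inv_X p)\<^sup>2 + (inv_Y p)\<^sup>2 = (depth p)\<^sup>2 * (2 - depth p) * (2 * R - depth p) / R\<^sup>2"
proof -
  have "(inv_X p)\<^sup>2 + (inv_Y p)\<^sup>2
      = ((fst p $ 1)\<^sup>2 + (fst p $ 2)\<^sup>2) * ((snd p $ 1)\<^sup>2 + (snd p $ 2)\<^sup>2)"
    by (simp add: inv_X_def inv_Y_def power2_eq_square algebra_simps)
  also have "\<dots> = (depth p)\<^sup>2 * (2 - depth p) * (2 * R - depth p) / R\<^sup>2"
    unfolding radius_1[OF assms] radius_2[OF assms] by (simp add: power2_eq_square)
  finally show ?thesis .
qed

lemma depth_bounds:
  assumes "p \<in> level L 0"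
  shows "0 \<le> depth p" "depth p \<le> 2 * half_depth"
proof -
  have "0 \<le> depth p * (2 - depth p)" using radius_1[OF assms] by (metis sum_power2_ge_zero)
  then show 0: "0 \<le> depth p" by (auto simp: zero_le_mult_iff)
  with \<open>0 \<le> depth p * (2 - depth p)\<close> have "depth p \<le> 2" by (auto simp: zero_le_mult_iff)
  have "0 \<le> depth p * (2 * R - depth p) / R\<^sup>2" using radius_2[OF assms] by (metis sum_power2_ge_zero)
  then have "0 \<le> depth p * (2 * R - depth p)" using R by (simp add: zero_le_divide_iff)
  then have "depth p \<le> 2 * R" using 0 R by (auto simp: zero_le_mult_iff)
  with \<open>depth p \<le> 2\<close> show "depth p \<le> 2 * half_depth" by (simp add: half_depth_def)
qed

lemma orbit_eq_iff:
  assumes "p \<in> level L 0" "p' \<in> level L 0"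
  shows "flow_orbit w L p = flow_orbit w L p' \<longleftrightarrow> depth p = depth p' \<and> inv_X p = inv_X p' \<and> inv_Y p = inv_Y p'"
  using flow_orbit_eq_iff[OF R1 R2 level_mem[OF assms(1)] level_mem[OF assms(2)]]
  by (auto simp: snd_3 assms fst_3)

lemma scale_pos: "0 < s \<Longrightarrow> s < 2 * half_depth \<Longrightarrow> 0 < scale s"
  using R by (simp add: scale_def half_depth_def)

lemma scale_square:
  assumes "0 < s" "s < 2 * half_depth"
  shows "(scale s)\<^sup>2 * (s * (2 - s) * (2 * R - s)) = R\<^sup>2"
proof -
  have "(R / sqrt P)\<^sup>2 * P = R\<^sup>2" if "P > 0" for P
    using that by (simp add: power_divide)
  moreover have "0 < s * (2 - s) * (2 * R - s)" using assms by (simp add: half_depth_def)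
  ultimately show ?thesis unfolding scale_def by blast
qed

lemma quot_coord_radius:
  assumes p: "p \<in> level L 0" and s: "0 < depth p" "depth p < 2 * half_depth"
  shows "(quot_coord p $ 1)\<^sup>2 + (quot_coord p $ 2)\<^sup>2 = depth p"
proof -
  have "(quot_coord p $ 1)\<^sup>2 + (quot_coord p $ 2)\<^sup>2 = (scale (depth p))\<^sup>2 * ((inv_X p)\<^sup>2 + (inv_Y p)\<^sup>2)"
    by (simp add: quot_coord_def power_mult_distrib algebra_simps)
  also have "\<dots> = depth p * ((scale (depth p))\<^sup>2 * (depth p * (2 - depth p) * (2 * R - depth p))) / R\<^sup>2"
    unfolding inv_X_Y_radius[OF p] by (simp add: power2_eq_square)
  also have "\<dots> = depth p" unfolding scale_square[OF s] using R by simp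
  finally show ?thesis .
qed

lemma quot_coord_separates_orbits:
  assumes "p \<in> level L 0" "0 < depth p" "depth p < 2 * half_depth" "p' \<in> level L 0" "0 < depth p'" "depth p' < 2 * half_depth"
    and "quot_coord p = quot_coord p'"
  shows "flow_orbit w L p = flow_orbit w L p'"
proof -
  have depth: "depth p = depth p'" using assms quot_coord_radius by metis
  have "quot_coord p $ 1 = quot_coord p' $ 1" "quot_coord p $ 2 = quot_coord p' $ 2" using assms by simp_all
  then have "inv_X p = inv_X p'" "inv_Y p = inv_Y p'"
    using scale_pos[of "depth p'"] assms depth by (simp_all add: quot_coord_def)
  then show ?thesis using depth orbit_eq_iff assms by blast
qed

lemma scale_has_derivative:
  assumes "0 < s" "s < 2 * half_depth"
  shows "(scale has_real_derivative deriv scale s) (at s)"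
proof -
  define P where "P x = x * (2 - x) * (2 * R - x)" for x
  have pos: "0 < P s" using assms by (simp add: half_depth_def P_def)
  have P': "(P has_real_derivative ((2 - s) * (2 * R - s) - s * (2 * R - s) - s * (2 - s))) (at s)"
    unfolding P_def by (auto intro!: derivative_eq_intros simp: algebra_simps)
  have "sqrt (P s) \<noteq> 0" using pos by simp
  from DERIV_divide[OF DERIV_const[of R] DERIV_chain2[OF DERIV_real_sqrt[OF pos] P'] this]
  show ?thesis unfolding scale_def[abs_def] P_def[symmetric] by (metis DERIV_imp_deriv)
qed

text \<open>
  With \<open>W = X dY - Y dX\<close>, the radial part of the differential of the coordinate is \<open>ds / 2\<close> and its angular
  part is \<open>h\<^sup>2 W\<close>, the derivative \<open>k\<close> of the scale having dropped out. On the other side,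
  \<open>W\<close> combines the angle forms of the two spheres, and on the level set \<open>R\<^sub>2 dz\<^sub>2 = - R\<^sub>1 dz\<^sub>1\<close> combines the
  two cylindrical area forms into a multiple of \<open>W \<and> dz\<^sub>1\<close>. Comparing the two gives the factor \<open>2 R\<^sub>1\<close>.
\<close>

lemma reduced_form_algebra:
  fixes h k :: real
  assumes p: "p \<in> level L 0" and s: "0 < depth p" "depth p < 2 * half_depth"
    and tan: "a \<in> tangent p" "b \<in> tangent p"
    and La: "R1 * fst a $ 3 + R2 * snd a $ 3 = 0" and Lb: "R1 * fst b $ 3 + R2 * snd b $ 3 = 0"
    and h: "h = scale (depth p)"
    and Q1: "\<And>v. Q1 v = - k * fst v $ 3 * inv_X p + h * d_inv_X p v"
    and Q2: "\<And>v. Q2 v = - k * fst v $ 3 * inv_Y p + h * d_inv_Y p v"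
    and radial: "2 * (quot_coord p $ 1 * Q1 a + quot_coord p $ 2 * Q2 a) = - fst a $ 3"
      "2 * (quot_coord p $ 1 * Q1 b + quot_coord p $ 2 * Q2 b) = - fst b $ 3"
  shows "w p a b = 2 * R1 * (Q1 a * Q2 b - Q2 a * Q1 b)"
proof -
  define W where "W v = inv_X p * d_inv_Y p v - inv_Y p * d_inv_X p v" for v
  define N1 where "N1 = (fst p $ 1)\<^sup>2 + (fst p $ 2)\<^sup>2"
  define N2 where "N2 = (snd p $ 1)\<^sup>2 + (snd p $ 2)\<^sup>2"
  define T1 where "T1 v = fst p $ 1 * fst v $ 2 - fst p $ 2 * fst v $ 1" for v :: pt
  define T2 where "T2 v = snd p $ 1 * snd v $ 2 - snd p $ 2 * snd v $ 1" for v :: pt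
  have quot_coord: "quot_coord p $ 1 = h * inv_X p" "quot_coord p $ 2 = h * inv_Y p" by (simp_all add: quot_coord_def h)
  \<comment> \<open>The terms with \<open>k\<close> are multiples of \<open>X Y - Y X\<close>.\<close>
  have angular: "quot_coord p $ 1 * Q2 v - quot_coord p $ 2 * Q1 v = h\<^sup>2 * W v" for v
    unfolding quot_coord Q1 Q2 W_def by (simp add: algebra_simps power2_eq_square)
  have rad: "quot_coord p $ 1 * Q1 a + quot_coord p $ 2 * Q2 a = - fst a $ 3 / 2"
    "quot_coord p $ 1 * Q1 b + quot_coord p $ 2 * Q2 b = - fst b $ 3 / 2"
    using radial by simp_all
  have W: "W v = N1 * T2 v - N2 * T1 v" for v
    unfolding W_def N1_def N2_def T1_def T2_def inv_X_def inv_Y_def d_inv_X_def d_inv_Y_def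
    by (simp add: algebra_simps power2_eq_square)
  have "depth p * (Q1 a * Q2 b - Q2 a * Q1 b)
      = (quot_coord p $ 1 * Q1 a + quot_coord p $ 2 * Q2 a) * (quot_coord p $ 1 * Q2 b - quot_coord p $ 2 * Q1 b)
      - (quot_coord p $ 1 * Q1 b + quot_coord p $ 2 * Q2 b) * (quot_coord p $ 1 * Q2 a - quot_coord p $ 2 * Q1 a)"
    unfolding quot_coord_radius[OF p s, symmetric] by (simp add: algebra_simps power2_eq_square)
  also have "\<dots> = h\<^sup>2 / 2 * (fst b $ 3 * W a - fst a $ 3 * W b)"
    unfolding angular rad by (simp add: algebra_simps)
  finally have "2 * R1 * (depth p * (Q1 a * Q2 b - Q2 a * Q1 b))
      = 2 * R1 * (h\<^sup>2 / 2 * (fst b $ 3 * W a - fst a $ 3 * W b))" by (rule arg_cong)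
  then have det: "depth p * (2 * R1 * (Q1 a * Q2 b - Q2 a * Q1 b))
      = h\<^sup>2 * (R1 * (fst b $ 3 * W a - fst a $ 3 * W b))"
    by (simp only: mult.left_commute times_divide_eq_left times_divide_eq_right mult.assoc)
  have S1: "N1 * sphere_form (fst p) (fst a) (fst b) = T1 a * fst b $ 3 - T1 b * fst a $ 3"
    unfolding N1_def T1_def using level_mem[OF p] tan
    by (intro sphere_form_angle_height) (auto simp: mem_S2xS2 tangent_def)
  have S2: "N2 * sphere_form (snd p) (snd a) (snd b) = T2 a * snd b $ 3 - T2 b * snd a $ 3"
    unfolding N2_def T2_def using level_mem[OF p] tan
    by (intro sphere_form_angle_height) (auto simp: mem_S2xS2 tangent_def)
  have La': "R2 * snd a $ 3 = - R1 * fst a $ 3" and Lb': "R2 * snd b $ 3 = - R1 * fst b $ 3"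
    using La Lb by simp_all
  have "N1 * N2 * w p a b = - (R1 * N2 * (N1 * sphere_form (fst p) (fst a) (fst b))
      + R2 * N1 * (N2 * sphere_form (snd p) (snd a) (snd b)))"
    by (simp add: cam_form_def algebra_simps)
  also have "\<dots> = - (R1 * N2 * (T1 a * fst b $ 3 - T1 b * fst a $ 3)
      + N1 * (T2 a * (R2 * snd b $ 3) - T2 b * (R2 * snd a $ 3)))"
    unfolding S1 S2 by (simp add: algebra_simps)
  also have "\<dots> = R1 * (fst b $ 3 * W a - fst a $ 3 * W b)"
    unfolding La' Lb' W by (simp add: algebra_simps)
  finally have form: "N1 * N2 * w p a b = R1 * (fst b $ 3 * W a - fst a $ 3 * W b)" .
  have "h\<^sup>2 * (N1 * N2) = depth p * (h\<^sup>2 * (depth p * (2 - depth p) * (2 * R - depth p))) / R\<^sup>2"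
    unfolding N1_def N2_def radius_1[OF p] radius_2[OF p] by (simp add: power2_eq_square)
  then have "h\<^sup>2 * (N1 * N2) = depth p"
    unfolding h scale_square[OF s] using R by simp
  then have "depth p * w p a b = h\<^sup>2 * (N1 * N2 * w p a b)" by (metis mult.assoc)
  then have "depth p * w p a b = depth p * (2 * R1 * (Q1 a * Q2 b - Q2 a * Q1 b))"
    unfolding form det .
  then show ?thesis using s by simp
qed

text \<open>
  Only the derivative of a lift \<open>\<sigma>\<close> enters: it is tangent to the spheres and to the level set because
  \<open>\<sigma>\<close> stays in them, and its radial part is known because the squared radius equals the depth.
\<close>

lemma reduced_form:
  assumes D: "open D" "d \<in> D" and lev: "\<And>x. x \<in> D \<Longrightarrow> \<sigma> x \<in> level L 0"
    and s: "\<And>x. x \<in> D \<Longrightarrow> 0 < depth (\<sigma> x) \<and> depth (\<sigma> x) < 2 * half_depth"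
    and \<sigma>': "(\<sigma> has_derivative \<sigma>') (at d)"
  obtains Q where "((\<lambda>x. quot_coord (\<sigma> x)) has_derivative Q) (at d)"
    and "\<And>a b. w (\<sigma> d) (\<sigma>' a) (\<sigma>' b) = 2 * R1 * (Q a $ 1 * Q b $ 2 - Q a $ 2 * Q b $ 1)"
proof -
  note [derivative_intros] = has_derivative_nth_fst[OF \<sigma>'] has_derivative_nth_snd[OF \<sigma>']
    inv_X_has_derivative[OF \<sigma>'] inv_Y_has_derivative[OF \<sigma>']
  define p where "p = \<sigma> d"
  have p: "p \<in> level L 0" "0 < depth p" "depth p < 2 * half_depth" using lev s D by (auto simp: p_def)
  have u': "((\<lambda>x. depth (\<sigma> x)) has_derivative (\<lambda>v. - fst (\<sigma>' v) $ 3)) (at d)"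
    unfolding depth_def by (auto intro!: derivative_eq_intros)
  have wt': "((\<lambda>x. scale (depth (\<sigma> x))) has_derivative (\<lambda>v. (- fst (\<sigma>' v) $ 3) * deriv scale (depth p))) (at d)"
    unfolding p_def
    by (rule DERIV_compose_FDERIV[OF scale_has_derivative u']) (use p in \<open>simp_all add: p_def\<close>)
  define Q1 where "Q1 v = - deriv scale (depth p) * fst v $ 3 * inv_X p + scale (depth p) * d_inv_X p v" for v
  define Q2 where "Q2 v = - deriv scale (depth p) * fst v $ 3 * inv_Y p + scale (depth p) * d_inv_Y p v" for v
  have q1': "((\<lambda>x. scale (depth (\<sigma> x)) * inv_X (\<sigma> x)) has_derivative (\<lambda>v. Q1 (\<sigma>' v))) (at d)"
    by (rule has_derivative_eq_rhs[OF has_derivative_mult[OF wt' inv_X_has_derivative[OF \<sigma>']]])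
       (simp add: Q1_def fun_eq_iff p_def algebra_simps)
  have q2': "((\<lambda>x. scale (depth (\<sigma> x)) * inv_Y (\<sigma> x)) has_derivative (\<lambda>v. Q2 (\<sigma>' v))) (at d)"
    by (rule has_derivative_eq_rhs[OF has_derivative_mult[OF wt' inv_Y_has_derivative[OF \<sigma>']]])
       (simp add: Q2_def fun_eq_iff p_def algebra_simps)
  have tan: "\<sigma>' v \<in> tangent p" for v
  proof -
    have "((\<lambda>x. fst (\<sigma> x) \<bullet> fst (\<sigma> x)) has_derivative
        (\<lambda>v. fst p \<bullet> fst (\<sigma>' v) + fst (\<sigma>' v) \<bullet> fst p)) (at d)"
      "((\<lambda>x. snd (\<sigma> x) \<bullet> snd (\<sigma> x)) has_derivative
        (\<lambda>v. snd p \<bullet> snd (\<sigma>' v) + snd (\<sigma>' v) \<bullet> snd p)) (at d)"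
      unfolding p_def by (intro derivative_intros \<sigma>')+
    from this[THEN has_derivative_locally_constant[OF _ D, of _ _ 1]] lev
    show ?thesis by (auto simp: tangent_def fun_eq_iff inner_commute level_def mem_S2xS2)
  qed
  have Lv: "R1 * fst (\<sigma>' v) $ 3 + R2 * snd (\<sigma>' v) $ 3 = 0" for v
  proof -
    have "((\<lambda>x. L (\<sigma> x)) has_derivative (\<lambda>v. R1 * fst (\<sigma>' v) $ 3 + R2 * snd (\<sigma>' v) $ 3)) (at d)"
      using has_derivative_compose[OF \<sigma>' cam_L_has_derivative] .
    from has_derivative_locally_constant[OF this D, of 0] lev
    show ?thesis by (auto simp: level_def fun_eq_iff)
  qed
  have rad: "2 * (quot_coord p $ 1 * Q1 (\<sigma>' v) + quot_coord p $ 2 * Q2 (\<sigma>' v)) = - fst (\<sigma>' v) $ 3" for v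
  proof -
    have "((\<lambda>x. (scale (depth (\<sigma> x)) * inv_X (\<sigma> x))\<^sup>2 + (scale (depth (\<sigma> x)) * inv_Y (\<sigma> x))\<^sup>2 - depth (\<sigma> x)) has_derivative
        (\<lambda>v. 2 * (quot_coord p $ 1 * Q1 (\<sigma>' v) + quot_coord p $ 2 * Q2 (\<sigma>' v)) + fst (\<sigma>' v) $ 3)) (at d)"
      by (rule derivative_eq_intros q1' q2' u' refl)+ (simp add: quot_coord_def p_def fun_eq_iff algebra_simps)
    from has_derivative_locally_constant[OF this D, of 0]
    have "(\<lambda>v. 2 * (quot_coord p $ 1 * Q1 (\<sigma>' v) + quot_coord p $ 2 * Q2 (\<sigma>' v)) + fst (\<sigma>' v) $ 3) = (\<lambda>_. 0)"
      using quot_coord_radius[OF lev] s by (simp add: quot_coord_def)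
    then have "2 * (quot_coord p $ 1 * Q1 (\<sigma>' v) + quot_coord p $ 2 * Q2 (\<sigma>' v)) + fst (\<sigma>' v) $ 3 = 0"
      by (rule fun_cong)
    then show ?thesis by linarith
  qed
  show ?thesis
  proof
    show "((\<lambda>x. quot_coord (\<sigma> x)) has_derivative (\<lambda>v. vector [Q1 (\<sigma>' v), Q2 (\<sigma>' v)])) (at d)"
      unfolding quot_coord_def by (intro derivative_intros q1' q2')
    show "w (\<sigma> d) (\<sigma>' a) (\<sigma>' b) = 2 * R1 * (vector [Q1 (\<sigma>' a), Q2 (\<sigma>' a)] $ (1::2)
        * vector [Q1 (\<sigma>' b), Q2 (\<sigma>' b)] $ (2::2) - vector [Q1 (\<sigma>' a), Q2 (\<sigma>' a)] $ (2::2)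
        * vector [Q1 (\<sigma>' b), Q2 (\<sigma>' b)] $ (1::2))" for a b
      using reduced_form_algebra[OF p tan tan Lv Lv refl Q1_def Q2_def rad rad]
      by (simp add: p_def)
  qed
qed

end

section \<open>The reduced area as a plane Lebesgue measure\<close>

lemma vec2_norm_square: "(norm (y :: real^2))\<^sup>2 = (y $ 1)\<^sup>2 + (y $ 2)\<^sup>2"
  unfolding power2_norm_eq_inner by (simp add: inner_vec_def sum_2 power2_eq_square)

lemma det_matrix_2:
  fixes Q :: "real^2 \<Rightarrow> real^2"
  shows "det (matrix Q) = Q (axis 1 1) $ 1 * Q (axis 2 1) $ 2 - Q (axis 1 1) $ 2 * Q (axis 2 1) $ 1"
  by (simp add: det_2 matrix_def)

context cam_params
begin

text \<open>\<open>H\<close> in terms of the plane coordinate, see \<open>cam_H_eq_energy\<close>.\<close>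

definition energy :: "real \<Rightarrow> real^2 \<Rightarrow> real" where
  "energy t y = (let s = (y $ 1)\<^sup>2 + (y $ 2)\<^sup>2 in
     s * (t / R - (1 - 2 * t) - t * s / R) + t * y $ 1 * sqrt (s * (2 - s) * (2 * R - s)) / R)"

definition annulus :: "(real^2) set" where
  "annulus = {y. 0 < (y $ 1)\<^sup>2 + (y $ 2)\<^sup>2 \<and> (y $ 1)\<^sup>2 + (y $ 2)\<^sup>2 < 2 * half_depth}"

definition sublevel :: "real \<Rightarrow> (real^2) set" where
  "sublevel t = {y \<in> annulus. energy t y < 0}"

lemma cam_H_eq:
  assumes "p \<in> level L 0"
  shows "cam_H t p = depth p * (t / R - (1 - 2 * t) - t * depth p / R) + t * inv_X p"
proof -
  have "cam_H t p = (1 - t) * (1 - depth p) + t * (inv_X p + (1 - depth p) * (depth p / R - 1)) + 2 * t - 1"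
    unfolding cam_H_def inv_X_def fst_3 snd_3[OF assms] ..
  also have "\<dots> = depth p * (t / R - (1 - 2 * t) - t * depth p / R) + t * inv_X p"
    using R by (simp add: field_simps)
  finally show ?thesis .
qed

lemma cam_H_eq_energy:
  assumes p: "p \<in> level L 0" and s: "0 < depth p" "depth p < 2 * half_depth"
  shows "cam_H t p = energy t (quot_coord p)"
proof -
  have "0 < depth p * (2 - depth p) * (2 * R - depth p)" using s by (simp add: half_depth_def)
  moreover have "R / sqrt P * x * sqrt P / R = x" if "0 < P" for P x
    using that R by simp
  ultimately have "quot_coord p $ 1 * sqrt (depth p * (2 - depth p) * (2 * R - depth p)) / R = inv_X p"
    by (simp only: quot_coord_def scale_def vector_2)
  then have "t * quot_coord p $ 1 * sqrt (depth p * (2 - depth p) * (2 * R - depth p)) / R = t * inv_X p"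
    by (metis mult.assoc times_divide_eq_right)
  then show ?thesis
    unfolding energy_def quot_coord_radius[OF p s] Let_def cam_H_eq[OF p] by simp
qed

text \<open>
  Depth \<open>0\<close> is the focus-focus point, where \<open>H\<close> vanishes; so the singular orbit is not in the region.
\<close>

lemma depth_pos_if_negative_energy:
  assumes p: "p \<in> level L 0" and "cam_H t p < 0"
  shows "0 < depth p"
proof (rule ccontr)
  assume "\<not> 0 < depth p"
  then have "depth p = 0" using depth_bounds[OF p] by simp
  then have "(inv_X p)\<^sup>2 + (inv_Y p)\<^sup>2 = 0" using inv_X_Y_radius[OF p] by simp
  then have "inv_X p = 0" by (simp add: sum_power2_eq_zero_iff)
  with \<open>depth p = 0\<close> show False using assms(2) cam_H_eq[OF p] by simp
qed

lemma quot_coord_in_annulus: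
  assumes "p \<in> level L 0" "0 < depth p" "depth p < 2 * half_depth"
  shows "quot_coord p \<in> annulus"
  using assms quot_coord_radius[OF assms] by (simp add: annulus_def)

lemma open_annulus: "open annulus"
  unfolding annulus_def by (intro open_Collect_conj open_Collect_less continuous_intros)

lemma bounded_annulus: "bounded annulus"
proof (rule bounded_subset[OF bounded_ball])
  show "annulus \<subseteq> ball 0 (sqrt (2 * half_depth))"
    by (auto simp: annulus_def vec2_norm_square[symmetric] intro!: real_less_rsqrt)
qed

lemma open_sublevel: "open (sublevel t)"
proof -
  have "continuous_on UNIV (energy t)"
    unfolding energy_def Let_def using R by (intro continuous_intros) auto
  then have "open {y. energy t y < 0}"
    by (intro open_Collect_less) auto
  moreover have "sublevel t = annulus \<inter> {y. energy t y < 0}" by (auto simp: sublevel_def)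
  ultimately show ?thesis using open_annulus by auto
qed

lemma lmeasurable_sublevel: "sublevel t \<in> lmeasurable"
  by (rule lmeasurable_open[OF _ open_sublevel])
     (rule bounded_subset[OF bounded_annulus], auto simp: sublevel_def)

text \<open>
  At the far end one of the vectors is a pole, so the whole circle of angles is a single orbit there.
  This is why a parametrization meets the far end at most once, and losing that end costs no area.
\<close>

lemma orbits_at_far_end_equal:
  assumes p: "p \<in> level L 0" "depth p = 2 * half_depth" and p': "p' \<in> level L 0" "depth p' = 2 * half_depth"
  shows "flow_orbit w L p = flow_orbit w L p'"
proof -
  have "(2 - 2 * half_depth) * (2 * R - 2 * half_depth) = 0" by (auto simp: half_depth_def min_def)
  then have 0: "(2 * half_depth)\<^sup>2 * (2 - 2 * half_depth) * (2 * R - 2 * half_depth) / R\<^sup>2 = 0" by simp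
  have "(inv_X p)\<^sup>2 + (inv_Y p)\<^sup>2 = 0" "(inv_X p')\<^sup>2 + (inv_Y p')\<^sup>2 = 0"
    unfolding inv_X_Y_radius[OF p(1)] inv_X_Y_radius[OF p'(1)] p(2) p'(2) 0 by (rule refl)+
  then show ?thesis using orbit_eq_iff[OF p(1) p'(1)] p p' by (simp add: sum_power2_eq_zero_iff)
qed

text \<open>
  The plane coordinate is defined away from the far end, which the parametrization meets in at most
  one point. On the rest of the domain its composition with \<open>\<sigma>\<close> is injective, because \<open>\<sigma>\<close> meets each orbit at most
  once, and the integrand is \<open>2 R\<^sub>1\<close> times its Jacobian.
\<close>

lemma param_area_eq_measure:
  assumes param: "quotient_param w L 0 D \<sigma>" and pos: "\<And>d. d \<in> D \<Longrightarrow> 0 < depth (\<sigma> d)"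
  defines "D' \<equiv> {d \<in> D. depth (\<sigma> d) < 2 * half_depth}"
  shows "(\<lambda>d. quot_coord (\<sigma> d)) ` D' \<in> lmeasurable"
    and "param_area w D \<sigma> = ennreal (2 * R1 * measure lebesgue ((\<lambda>d. quot_coord (\<sigma> d)) ` D'))"
proof -
  let ?g = "\<lambda>d. quot_coord (\<sigma> d)"
  define \<sigma>' where "\<sigma>' d = frechet_derivative \<sigma> (at d)" for d
  have D: "open D" and lev: "\<And>d. d \<in> D \<Longrightarrow> \<sigma> d \<in> level L 0"
    and inj: "inj_on (\<lambda>d. flow_orbit w L (\<sigma> d)) D"
    and \<sigma>': "\<And>d. d \<in> D \<Longrightarrow> (\<sigma> has_derivative \<sigma>' d) (at d)"
    using param unfolding quotient_param_def \<sigma>'_def by (auto simp: frechet_derivative_works)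
  have "d1 = d2" if "d1 \<in> D - D'" "d2 \<in> D - D'" for d1 d2
  proof -
    have "depth (\<sigma> d1) = 2 * half_depth" "depth (\<sigma> d2) = 2 * half_depth"
      using that depth_bounds(2)[OF lev] by (force simp: D'_def)+
    then have "flow_orbit w L (\<sigma> d1) = flow_orbit w L (\<sigma> d2)"
      using orbits_at_far_end_equal lev that by auto
    then show ?thesis using inj that by (auto dest: inj_onD)
  qed
  then have "\<exists>d0. D - D' \<subseteq> {d0}" by blast
  then have fin: "finite (D - D')" by (auto intro: finite_subset)
  have "open (D - (D - D'))" using D fin by (intro open_Diff finite_imp_closed)
  moreover have "D - (D - D') = D'" by (auto simp: D'_def)
  ultimately have D': "open D'" by simp
  have lev': "\<And>d. d \<in> D' \<Longrightarrow> \<sigma> d \<in> level L 0" and u': "\<And>d. d \<in> D' \<Longrightarrow> 0 < depth (\<sigma> d) \<and> depth (\<sigma> d) < 2 * half_depth"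
    using lev pos by (auto simp: D'_def)
  have inj': "inj_on ?g D'"
  proof (rule inj_onI)
    fix d1 d2 assume "d1 \<in> D'" "d2 \<in> D'" "?g d1 = ?g d2"
    then have "flow_orbit w L (\<sigma> d1) = flow_orbit w L (\<sigma> d2)"
      using quot_coord_separates_orbits lev' u' by blast
    then show "d1 = d2" using inj \<open>d1 \<in> D'\<close> \<open>d2 \<in> D'\<close> by (auto simp: D'_def dest: inj_onD)
  qed
  have "\<exists>Q. (?g has_derivative Q) (at d) \<and>
      \<bar>w (\<sigma> d) (\<sigma>' d (axis 1 1)) (\<sigma>' d (axis 2 1))\<bar> = 2 * R1 * \<bar>det (matrix Q)\<bar>" if d: "d \<in> D'" for d
  proof -
    obtain Q where "(?g has_derivative Q) (at d)"
      "\<And>a b. w (\<sigma> d) (\<sigma>' d a) (\<sigma>' d b) = 2 * R1 * (Q a $ 1 * Q b $ 2 - Q a $ 2 * Q b $ 1)"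
      using reduced_form[OF D' d lev' u' \<sigma>'] d D'_def by blast
    then show ?thesis using R1 by (auto simp: det_matrix_2 abs_mult)
  qed
  then obtain Q where Q: "\<And>d. d \<in> D' \<Longrightarrow> (?g has_derivative Q d) (at d)"
    and dens: "\<And>d. d \<in> D' \<Longrightarrow>
      \<bar>w (\<sigma> d) (\<sigma>' d (axis 1 1)) (\<sigma>' d (axis 2 1))\<bar> = 2 * R1 * \<bar>det (matrix (Q d))\<bar>"
    by metis
  have D'_leb: "D' \<in> sets lebesgue" using D' by simp
  have Qw: "\<And>d. d \<in> D' \<Longrightarrow> (?g has_derivative Q d) (at d within D')"
    using Q has_derivative_at_withinI by blast
  have "?g ` D' \<in> sets lebesgue"
    by (rule differentiable_image_in_sets_lebesgue[OF D'_leb])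
       (use Qw in \<open>auto simp: differentiable_on_def differentiable_def\<close>)
  moreover have "bounded (?g ` D')"
    by (rule bounded_subset[OF bounded_annulus]) (use quot_coord_in_annulus[OF lev'] u' in blast)
  ultimately show meas: "?g ` D' \<in> lmeasurable"
    by (rule bounded_set_imp_lmeasurable[rotated])
  then have "((\<lambda>d. \<bar>det (matrix (Q d))\<bar>) has_integral measure lebesgue (?g ` D')) D'"
    using has_measure_differentiable_image[OF D'_leb Qw inj'] by blast
  then have I: "((\<lambda>d. 2 * R1 * \<bar>det (matrix (Q d))\<bar>) has_integral 2 * R1 * measure lebesgue (?g ` D')) D'"
    by (rule has_integral_mult_right)
  have "param_area w D \<sigma> = (\<integral>\<^sup>+ d. ennreal (2 * R1 * \<bar>det (matrix (Q d))\<bar>) * indicator D' d \<partial>lborel)"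
    unfolding param_area_def \<sigma>'_def[symmetric]
  proof (rule nn_integral_cong_AE)
    have "AE d in lborel. d \<notin> D - D'"
      by (rule AE_not_in[OF finite_imp_null_set_lborel[OF fin]])
    then show "AE d in lborel. ennreal \<bar>w (\<sigma> d) (\<sigma>' d (axis 1 1)) (\<sigma>' d (axis 2 1))\<bar> * indicator D d
        = ennreal (2 * R1 * \<bar>det (matrix (Q d))\<bar>) * indicator D' d"
    proof eventually_elim
      case (elim d)
      then show ?case by (cases "d \<in> D'") (auto simp: dens indicator_def D'_def)
    qed
  qed
  also have "\<dots> = ennreal (2 * R1 * measure lebesgue (?g ` D'))"
    by (rule nn_integral_has_integral_lebesgue'[OF _ I]) (use R1 in auto)
  finally show "param_area w D \<sigma> = ennreal (2 * R1 * measure lebesgue (?g ` D'))" .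
qed

text \<open>
  The section of the quotient whose first vector has a fixed longitude; the second vector is placed so
  that \<open>cnj \<zeta>\<^sub>1 * \<zeta>\<^sub>2\<close> has the direction of \<open>y\<close>.
\<close>

definition lift :: "real^2 \<Rightarrow> pt" where
  "lift y = (let s = (y $ 1)\<^sup>2 + (y $ 2)\<^sup>2 in
     (vector [sqrt (s * (2 - s)), 0, 1 - s],
      vector [y $ 1 * sqrt (2 * R - s) / R, y $ 2 * sqrt (2 * R - s) / R, s / R - 1]))"

definition lift_deriv :: "real^2 \<Rightarrow> real^2 \<Rightarrow> pt" where
  "lift_deriv y v = (let s = (y $ 1)\<^sup>2 + (y $ 2)\<^sup>2; ds = 2 * (y $ 1 * v $ 1 + y $ 2 * v $ 2);
       dr = - ds / (2 * sqrt (2 * R - s)) in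
     (vector [(1 - s) * ds / sqrt (s * (2 - s)), 0, - ds],
      vector [(v $ 1 * sqrt (2 * R - s) + y $ 1 * dr) / R,
              (v $ 2 * sqrt (2 * R - s) + y $ 2 * dr) / R, ds / R]))"

lemma lift_has_derivative:
  assumes "y \<in> annulus"
  shows "(lift has_derivative lift_deriv y) (at y)"
proof -
  define s where "s y = (y $ 1)\<^sup>2 + (y $ 2)\<^sup>2" for y :: "real^2"
  define ds where "ds v = 2 * (y $ 1 * v $ 1 + y $ 2 * v $ 2)" for v :: "real^2"
  have pos: "0 < s y" "0 < s y * (2 - s y)" "0 < 2 * R - s y"
    using assms by (auto simp: annulus_def half_depth_def s_def)
  note [derivative_intros] = bounded_linear_imp_has_derivative[OF bounded_linear_vec_nth]
  have s': "(s has_derivative ds) (at y)"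
    unfolding s_def ds_def by (rule derivative_eq_intros refl)+ (simp add: fun_eq_iff algebra_simps)
  have "((\<lambda>y. s y * (2 - s y)) has_derivative (\<lambda>v. 2 * ((1 - s y) * ds v))) (at y)"
    by (rule derivative_eq_intros s' refl)+ (simp add: fun_eq_iff algebra_simps)
  from DERIV_compose_FDERIV[OF DERIV_real_sqrt[OF pos(2)] this]
  have a: "((\<lambda>y. sqrt (s y * (2 - s y))) has_derivative
      (\<lambda>v. (1 - s y) * ds v / sqrt (s y * (2 - s y)))) (at y)"
    by (rule has_derivative_eq_rhs) (simp add: fun_eq_iff inverse_eq_divide)
  have "((\<lambda>y. 2 * R - s y) has_derivative (\<lambda>v. - ds v)) (at y)"
    by (rule derivative_eq_intros s' refl)+ simp
  from DERIV_compose_FDERIV[OF DERIV_real_sqrt[OF pos(3)] this]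
  have b: "((\<lambda>y. sqrt (2 * R - s y)) has_derivative
      (\<lambda>v. - ds v / (2 * sqrt (2 * R - s y)))) (at y)"
    by (rule has_derivative_eq_rhs) (simp add: fun_eq_iff field_simps)
  have c: "((\<lambda>y. y $ i * sqrt (2 * R - s y) / R) has_derivative
      (\<lambda>v. (v $ i * sqrt (2 * R - s y) + y $ i * (- ds v / (2 * sqrt (2 * R - s y)))) / R)) (at y)" for i
  proof -
    have "((\<lambda>y. y $ i * sqrt (2 * R - s y)) has_derivative
      (\<lambda>v. v $ i * sqrt (2 * R - s y) + y $ i * (- ds v / (2 * sqrt (2 * R - s y))))) (at y)"
      by (rule has_derivative_eq_rhs[OF has_derivative_mult[OF bounded_linear_imp_has_derivative[OF bounded_linear_vec_nth] b]])
         (simp add: fun_eq_iff)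
    then show ?thesis using bounded_linear.has_derivative[OF bounded_linear_divide] by blast
  qed
  have "((\<lambda>y. (vector [sqrt (s y * (2 - s y)), 0, 1 - s y] :: real^3,
      vector [y $ 1 * sqrt (2 * R - s y) / R, y $ 2 * sqrt (2 * R - s y) / R, s y / R - 1] :: real^3))
      has_derivative (\<lambda>v. (vector [(1 - s y) * ds v / sqrt (s y * (2 - s y)), 0, - ds v],
        vector [(v $ 1 * sqrt (2 * R - s y) + y $ 1 * (- ds v / (2 * sqrt (2 * R - s y)))) / R,
          (v $ 2 * sqrt (2 * R - s y) + y $ 2 * (- ds v / (2 * sqrt (2 * R - s y)))) / R, ds v / R]))) (at y)"
  proof (intro has_derivative_Pair has_derivative_vector_3 a c)
    show "((\<lambda>y. 1 - s y) has_derivative (\<lambda>v. - ds v)) (at y)"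
      by (rule derivative_eq_intros s' refl)+ simp
    show "((\<lambda>y. s y / R - 1) has_derivative (\<lambda>v. ds v / R)) (at y)"
      using has_derivative_diff[OF bounded_linear.has_derivative[OF bounded_linear_divide s'] has_derivative_const[of 1]]
      by simp
  qed (rule has_derivative_const)
  then show ?thesis unfolding lift_def[abs_def] lift_deriv_def[abs_def] Let_def s_def ds_def by simp
qed

lemma continuous_on_lift_deriv: "continuous_on annulus (\<lambda>y. lift_deriv y v)"
  unfolding lift_deriv_def Let_def
  by (intro continuous_intros) (use R in \<open>auto simp: annulus_def half_depth_def\<close>)

lemma depth_lift: "depth (lift y) = (y $ 1)\<^sup>2 + (y $ 2)\<^sup>2"
  by (simp add: depth_def lift_def Let_def)

lemma lift_in_level:
  assumes "y \<in> annulus"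
  shows "lift y \<in> level L 0"
proof -
  define s where "s = (y $ 1)\<^sup>2 + (y $ 2)\<^sup>2"
  have pos: "0 < s * (2 - s)" "0 < 2 * R - s"
    using assms by (auto simp: annulus_def half_depth_def s_def)
  have lift: "lift y = (vector [sqrt (s * (2 - s)), 0, 1 - s],
      vector [y $ 1 * sqrt (2 * R - s) / R, y $ 2 * sqrt (2 * R - s) / R, s / R - 1])"
    by (simp add: lift_def Let_def s_def)
  have "fst (lift y) \<bullet> fst (lift y) = (sqrt (s * (2 - s)))\<^sup>2 + (1 - s)\<^sup>2"
    by (simp add: lift inner_3 power2_eq_square)
  also have "\<dots> = 1" using pos by (simp add: power2_eq_square algebra_simps)
  finally have 1: "fst (lift y) \<bullet> fst (lift y) = 1" .
  have "snd (lift y) \<bullet> snd (lift y) = s * (sqrt (2 * R - s))\<^sup>2 / R\<^sup>2 + (s / R - 1)\<^sup>2"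
    using R by (simp add: lift inner_3 s_def field_simps power2_eq_square)
  also have "\<dots> = 1" using pos R by (simp add: field_simps power2_eq_square)
  finally have 2: "snd (lift y) \<bullet> snd (lift y) = 1" .
  have "L (lift y) = 0"
    using R1 R2 by (simp add: cam_L_def lift R_def)
  with 1 2 show ?thesis by (simp add: level_def mem_S2xS2)
qed

lemma quot_coord_lift:
  assumes "y \<in> annulus"
  shows "quot_coord (lift y) = y"
proof -
  define s where "s = (y $ 1)\<^sup>2 + (y $ 2)\<^sup>2"
  have pos: "0 < sqrt (s * (2 - s))" "0 < sqrt (2 * R - s)"
    using assms by (auto simp: annulus_def half_depth_def s_def)
  have "scale s = R / (sqrt (s * (2 - s)) * sqrt (2 * R - s))"
    by (simp add: scale_def real_sqrt_mult)
  moreover have "R / (a * b) * (a * (x * b / R)) = x" if "0 < a" "0 < b" for a b x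
    using that R by simp
  ultimately have "scale s * (sqrt (s * (2 - s)) * (x * sqrt (2 * R - s) / R)) = x" for x
    using pos by metis
  then show ?thesis
    unfolding quot_coord_def depth_lift s_def[symmetric]
    by (simp add: inv_X_def inv_Y_def lift_def Let_def s_def[symmetric] vec_eq_iff forall_2)
qed

lemma quotient_param_lift: "quotient_param w L 0 (sublevel t) lift"
  unfolding quotient_param_def
proof (intro conjI ballI allI)
  have sub: "sublevel t \<subseteq> annulus" by (auto simp: sublevel_def)
  show "open (sublevel t)" by (rule open_sublevel)
  show "lift differentiable (at d)" if "d \<in> sublevel t" for d
    using lift_has_derivative sub that by (auto simp: differentiable_def)
  have "frechet_derivative lift (at d) = lift_deriv d" if "d \<in> sublevel t" for d
    using frechet_derivative_at[OF lift_has_derivative] sub that by auto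
  then show "continuous_on (sublevel t) (\<lambda>d. frechet_derivative lift (at d) v)" for v
    using continuous_on_subset[OF continuous_on_lift_deriv sub] by simp
  show "lift ` sublevel t \<subseteq> level L 0" using lift_in_level sub by auto
  show "inj_on (\<lambda>d. flow_orbit w L (lift d)) (sublevel t)"
  proof (rule inj_onI)
    fix d1 d2 assume d: "d1 \<in> sublevel t" "d2 \<in> sublevel t"
      and "flow_orbit w L (lift d1) = flow_orbit w L (lift d2)"
    then have "depth (lift d1) = depth (lift d2) \<and> inv_X (lift d1) = inv_X (lift d2) \<and> inv_Y (lift d1) = inv_Y (lift d2)"
      using orbit_eq_iff[OF lift_in_level lift_in_level] sub by blast
    then have "quot_coord (lift d1) = quot_coord (lift d2)" by (simp add: quot_coord_def)
    then show "d1 = d2" using quot_coord_lift d sub by (metis subsetD)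
  qed
qed

text \<open>
  Every admissible parametrization has its image in the sublevel region, and the
  section \<open>lift\<close> covers that region completely, so the supremum is attained there.
\<close>

lemma reduced_area_eq:
  "reduced_area w L 0 (flow_orbit w L ` {p \<in> level L 0. cam_H t p < 0})
    = ennreal (2 * R1 * measure lebesgue (sublevel t))"
proof -
  let ?A = "flow_orbit w L ` {p \<in> level L 0. cam_H t p < 0}"
  have A: "flow_orbit w L p \<in> ?A \<longleftrightarrow> cam_H t p < 0" if p: "p \<in> level L 0" for p
  proof
    assume "flow_orbit w L p \<in> ?A"
    then obtain p' where "p' \<in> level L 0" "cam_H t p' < 0" "flow_orbit w L p = flow_orbit w L p'"
      by blast
    then show "cam_H t p < 0" using orbit_eq_iff[OF p] cam_H_eq p by simp
  qed (use p in blast)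
  show ?thesis
    unfolding reduced_area_def
  proof (rule antisym)
    show "(SUP (D, \<sigma>) \<in> {(D, \<sigma>). quotient_param w L 0 D \<sigma> \<and> (\<forall>d \<in> D. flow_orbit w L (\<sigma> d) \<in> ?A)}.
        param_area w D \<sigma>) \<le> ennreal (2 * R1 * measure lebesgue (sublevel t))"
    proof (rule SUP_least, clarify)
      fix D \<sigma> assume param: "quotient_param w L 0 D \<sigma>" and "\<forall>d \<in> D. flow_orbit w L (\<sigma> d) \<in> ?A"
      then have lev: "\<sigma> d \<in> level L 0" and orb: "flow_orbit w L (\<sigma> d) \<in> ?A" if "d \<in> D" for d
        using that by (auto simp: quotient_param_def)
      have neg: "cam_H t (\<sigma> d) < 0" if "d \<in> D" for d
        using A[OF lev] orb that by blast
      have pos: "0 < depth (\<sigma> d)" if "d \<in> D" for d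
        using depth_pos_if_negative_energy lev neg that by blast
      let ?S = "(\<lambda>d. quot_coord (\<sigma> d)) ` {d \<in> D. depth (\<sigma> d) < 2 * half_depth}"
      have "?S \<subseteq> sublevel t"
      proof clarify
        fix d assume d: "d \<in> D" "depth (\<sigma> d) < 2 * half_depth"
        then show "quot_coord (\<sigma> d) \<in> sublevel t"
          using quot_coord_in_annulus[OF lev pos] cam_H_eq_energy[OF lev pos, of d t] neg[of d]
          by (simp add: sublevel_def)
      qed
      then have "measure lebesgue ?S \<le> measure lebesgue (sublevel t)"
        using param_area_eq_measure(1)[OF param pos] lmeasurable_sublevel
        by (intro measure_mono_fmeasurable) auto
      moreover have "param_area w D \<sigma> = ennreal (2 * R1 * measure lebesgue ?S)"
        by (rule param_area_eq_measure(2)[OF param pos])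
      ultimately show "param_area w D \<sigma> \<le> ennreal (2 * R1 * measure lebesgue (sublevel t))"
        using R1 by (simp add: ennreal_leI)
    qed
    have *: "y \<in> annulus" "energy t y < 0" if "y \<in> sublevel t" for y
      using that by (auto simp: sublevel_def)
    then have depth: "0 < depth (lift y)" "depth (lift y) < 2 * half_depth" if "y \<in> sublevel t" for y
      using that by (auto simp: depth_lift annulus_def)
    have "{d \<in> sublevel t. depth (lift d) < 2 * half_depth} = sublevel t" using depth by auto
    moreover have "(\<lambda>d. quot_coord (lift d)) ` sublevel t = sublevel t"
      using quot_coord_lift * by (auto simp: image_iff)
    ultimately have "param_area w (sublevel t) lift = ennreal (2 * R1 * measure lebesgue (sublevel t))"
      using param_area_eq_measure(2)[OF quotient_param_lift depth(1)] by simp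
    moreover have "flow_orbit w L (lift y) \<in> ?A" if "y \<in> sublevel t" for y
      using A[OF lift_in_level] cam_H_eq_energy[OF lift_in_level depth] quot_coord_lift * that by simp
    ultimately show "ennreal (2 * R1 * measure lebesgue (sublevel t)) \<le>
      (SUP (D, \<sigma>) \<in> {(D, \<sigma>). quotient_param w L 0 D \<sigma> \<and> (\<forall>d \<in> D. flow_orbit w L (\<sigma> d) \<in> ?A)}.
        param_area w D \<sigma>)"
      using quotient_param_lift by (intro SUP_upper2[of "(sublevel t, lift)"]) auto
  qed
qed

end

section \<open>Arguments of complex numbers in the closed upper half plane\<close>

text \<open>
  The argument of \<open>A + i s\<close> for \<open>s \<ge> 0\<close>, with values in \<open>[0, \<pi>]\<close>. Through the arccosine it is continuous
  up to \<open>s = 0\<close> for every \<open>A\<close>: when \<open>A = 0\<close>, the convention \<open>0 / 0 = 0\<close> gives the constant \<open>\<pi> / 2\<close>.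
\<close>

definition parg :: "real \<Rightarrow> real \<Rightarrow> real" where
  "parg A s = arccos (A / sqrt (A\<^sup>2 + s\<^sup>2))"

lemma parg_quot_bounds: "\<bar>A / sqrt (A\<^sup>2 + s\<^sup>2)\<bar> \<le> 1"
proof -
  have "\<bar>A\<bar> \<le> sqrt (A\<^sup>2 + s\<^sup>2)" by (rule real_le_rsqrt) simp
  then show ?thesis
    by (cases "A\<^sup>2 + s\<^sup>2 = 0") (simp_all add: abs_divide divide_le_eq_1 sum_power2_gt_zero_iff)
qed

lemma parg_quot_bounds': "- 1 \<le> A / sqrt (A\<^sup>2 + s\<^sup>2)" "A / sqrt (A\<^sup>2 + s\<^sup>2) \<le> 1"
  using parg_quot_bounds[of A s] unfolding abs_le_iff by linarith+

lemma parg_bounds: "0 \<le> parg A s" "parg A s \<le> pi"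
  using arccos_bounded[OF parg_quot_bounds'[of A s]] by (simp_all add: parg_def)

lemma cos_parg: "cos (parg A s) = A / sqrt (A\<^sup>2 + s\<^sup>2)"
  unfolding parg_def by (rule cos_arccos_abs[OF parg_quot_bounds])

lemma sin_parg:
  assumes "0 < s"
  shows "sin (parg A s) = s / sqrt (A\<^sup>2 + s\<^sup>2)"
proof -
  have "A\<^sup>2 / (A\<^sup>2 + s\<^sup>2) + s\<^sup>2 / (A\<^sup>2 + s\<^sup>2) = 1"
    using assms by (simp add: add_divide_distrib[symmetric])
  then have "1 - (A / sqrt (A\<^sup>2 + s\<^sup>2))\<^sup>2 = (s / sqrt (A\<^sup>2 + s\<^sup>2))\<^sup>2"
    by (simp add: power_divide)
  then have "sin (parg A s) = \<bar>s / sqrt (A\<^sup>2 + s\<^sup>2)\<bar>"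
    unfolding parg_def sin_arccos_abs[OF parg_quot_bounds] by simp
  then show ?thesis using assms by simp
qed

lemma parg_pos_zero: "0 < A \<Longrightarrow> parg A 0 = 0"
  and parg_neg_zero: "A < 0 \<Longrightarrow> parg A 0 = pi"
  and parg_zero: "parg 0 s = pi / 2"
  by (simp_all add: parg_def)

lemma parg_eq_arctan:
  assumes "0 < s"
  shows "parg A s = pi / 2 - arctan (A / s)"
proof -
  have *: "sqrt (1 + (A / s)\<^sup>2) = sqrt (A\<^sup>2 + s\<^sup>2) / s"
  proof -
    have "1 + (A / s)\<^sup>2 = (A\<^sup>2 + s\<^sup>2) / s\<^sup>2" using assms by (simp add: field_simps)
    then show ?thesis using assms by (simp add: real_sqrt_divide)
  qed
  have "cos (pi / 2 - arctan (A / s)) = sin (arctan (A / s))"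
    by (simp add: cos_diff)
  also have "\<dots> = A / sqrt (A\<^sup>2 + s\<^sup>2)"
    using assms by (simp add: sin_arctan *)
  finally have "parg A s = arccos (cos (pi / 2 - arctan (A / s)))"
    by (simp add: parg_def)
  also have "\<dots> = pi / 2 - arctan (A / s)"
    using arctan_bounded[of "A / s"] by (intro arccos_cos) auto
  finally show ?thesis .
qed

lemma arctan_quot_eq_parg:
  assumes "0 < r"
  shows "arctan_quot r A = parg A r"
proof (cases "A = 0")
  case True
  then show ?thesis by (simp add: arctan_quot_def parg_zero)
next
  case False
  then have "arctan (r / A) = (if 0 < A then pi / 2 else - pi / 2) - arctan (A / r)"
    using arctan_inverse[of "A / r"] arctan_inverse[of "- A / r"] assms
    by (cases "0 < A") (auto simp: arctan_minus divide_less_0_iff)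
  moreover have "arctan (r / A) < 0 \<longleftrightarrow> A < 0"
    using assms False by (simp add: divide_less_0_iff)
  ultimately show ?thesis
    using assms False by (auto simp: arctan_quot_def parg_eq_arctan sgn_if divide_less_0_iff)
qed

lemma continuous_on_parg: "continuous_on S (parg A)"
proof (cases "A = 0")
  case True
  then show ?thesis by (simp add: parg_zero[abs_def] continuous_on_const)
next
  case False
  then have "A\<^sup>2 + s\<^sup>2 \<noteq> 0" for s by (simp add: sum_power2_eq_zero_iff)
  then show ?thesis
    unfolding parg_def by (intro continuous_intros ballI) (simp_all only: parg_quot_bounds' real_sqrt_eq_0_iff not_False_eq_True)
qed

lemma continuous_on_parg_compose [continuous_intros]:
  "continuous_on S f \<Longrightarrow> continuous_on S (\<lambda>x. parg A (f x))"
  by (rule continuous_on_compose2[OF continuous_on_parg[of UNIV]]) auto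

text \<open>
  A primitive of \<open>2 s arg (A + i s)\<close>, from integration by parts with \<open>A\<^sup>2 + s\<^sup>2\<close> as the primitive of \<open>2 s\<close>,
  which cancels the denominator of \<open>A / (A\<^sup>2 + s\<^sup>2)\<close>, the derivative of the argument.
\<close>

definition parg_primitive :: "real \<Rightarrow> real \<Rightarrow> real" where
  "parg_primitive A s = (A\<^sup>2 + s\<^sup>2) * parg A s - A * s"

lemma parg_primitive_has_derivative:
  assumes "0 < s"
  shows "(parg_primitive A has_real_derivative 2 * s * parg A s) (at s)"
proof -
  have pos: "0 < A\<^sup>2 + s\<^sup>2" using assms by (simp add: add_nonneg_pos)
  have eq: "(- A / s\<^sup>2) / (1 + (A / s)\<^sup>2) = - (A / (A\<^sup>2 + s\<^sup>2))"
    using assms pos by (simp add: field_simps)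
  have "((\<lambda>s. A / s) has_real_derivative - A / s\<^sup>2) (at s)"
    using assms by (auto intro!: derivative_eq_intros simp: power2_eq_square)
  from DERIV_chain2[OF DERIV_arctan this]
  have "((\<lambda>s. arctan (A / s)) has_real_derivative - (A / (A\<^sup>2 + s\<^sup>2))) (at s)"
    by (rule DERIV_cong) (simp only: eq[symmetric] divide_inverse[of "- A / s\<^sup>2"] mult.commute)
  note arctan' = this
  have square': "((\<lambda>s. A\<^sup>2 + s\<^sup>2) has_real_derivative 2 * s) (at s)"
    by (auto intro!: derivative_eq_intros)
  have "((\<lambda>s. (A\<^sup>2 + s\<^sup>2) * (pi / 2 - arctan (A / s)) - A * s) has_real_derivative
      2 * s * (pi / 2 - arctan (A / s)) + (A\<^sup>2 + s\<^sup>2) * (A / (A\<^sup>2 + s\<^sup>2)) - A) (at s)"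
    by (rule DERIV_cong[OF DERIV_diff[OF DERIV_mult[OF square' DERIV_diff[OF DERIV_const arctan']]
          DERIV_cmult_Id]])
       (simp add: mult.commute)
  moreover have "(A\<^sup>2 + s\<^sup>2) * (A / (A\<^sup>2 + s\<^sup>2)) = A" using pos by simp
  ultimately have "((\<lambda>s. (A\<^sup>2 + s\<^sup>2) * (pi / 2 - arctan (A / s)) - A * s) has_real_derivative
      2 * s * parg A s) (at s)"
    by (simp add: parg_eq_arctan[OF assms])
  then show ?thesis
    by (rule has_field_derivative_transform_within_open[of _ _ _ "{0<..}"])
       (use assms in \<open>auto simp: parg_primitive_def parg_eq_arctan\<close>)
qed

lemma continuous_on_parg_primitive [continuous_intros]:
  "continuous_on S f \<Longrightarrow> continuous_on S (\<lambda>x. parg_primitive A (f x))"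
  unfolding parg_primitive_def by (intro continuous_intros)

lemma sin_parg_add:
  assumes "0 < s"
  shows "sin (parg A s + parg B s) = s * (A + B) / (sqrt (A\<^sup>2 + s\<^sup>2) * sqrt (B\<^sup>2 + s\<^sup>2))"
  using assms by (simp add: sin_add cos_parg sin_parg algebra_simps add_divide_distrib)

text \<open>
  The imaginary part \<open>s (A + B)\<close> of the product \<open>(A + i s) (B + i s)\<close> is not negative, so
  the sum of the arguments is the argument of the product, without a correction by \<open>2 \<pi>\<close>.
\<close>

lemma parg_add_le_pi:
  assumes AB: "0 < A + B" and s: "0 \<le> s"
  shows "parg A s + parg B s \<le> pi"
proof (cases "s = 0")
  case True
  have "0 < A \<or> 0 < B" using AB by linarith
  then show ?thesis using parg_bounds(2)[of A 0] parg_bounds(2)[of B 0]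
    by (auto simp: True parg_pos_zero)
next
  case False
  show ?thesis
  proof (rule ccontr)
    assume "\<not> parg A s + parg B s \<le> pi"
    then have "0 \<le> parg A s + parg B s - pi" "parg A s + parg B s - pi \<le> pi"
      using parg_bounds(2)[of A s] parg_bounds(2)[of B s] by linarith+
    from sin_ge_zero[OF this] have "sin (parg A s + parg B s) \<le> 0" by (simp add: sin_diff)
    moreover have "0 < sin (parg A s + parg B s)"
      unfolding sin_parg_add[OF False[symmetric, THEN le_neq_trans[OF s]]]
      using AB s False by (intro divide_pos_pos mult_pos_pos) (auto simp: add_nonneg_pos)
    ultimately show False by simp
  qed
qed

text \<open>
  The right-hand side \<open>A B - w\<close> is the real part of \<open>(A + i \<surd>w) (B + i \<surd>w)\<close> and the root is its
  modulus, so the inequality compares the cosine of \<open>\<theta>\<close> with that of the sum of the arguments.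
\<close>

lemma sector_iff_positive:
  assumes AB: "0 < A + B" and w: "0 < w" and \<theta>: "\<bar>\<theta>\<bar> \<le> pi"
  shows "sqrt ((A\<^sup>2 + w) * (B\<^sup>2 + w)) * cos \<theta> < A * B - w
    \<longleftrightarrow> parg A (sqrt w) + parg B (sqrt w) < \<bar>\<theta>\<bar>"
proof -
  let ?C = "parg A (sqrt w) + parg B (sqrt w)" and ?N = "sqrt ((A\<^sup>2 + w) * (B\<^sup>2 + w))"
  have N: "?N = sqrt (A\<^sup>2 + w) * sqrt (B\<^sup>2 + w)" "0 < ?N" "sqrt w * sqrt w = w" "0 < sqrt w"
    using w by (simp_all add: real_sqrt_mult add_nonneg_pos)
  have "cos ?C = (A * B - w) / ?N"
    unfolding cos_add using w N(1,3)
    by (simp add: cos_parg sin_parg diff_divide_distrib)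
  moreover have "y = n * x" if "x = y / n" "0 < n" for x y n :: real using that by simp
  ultimately have cosC: "A * B - w = ?N * cos ?C" using N(2) by blast
  have "?C \<le> pi" using AB N(4) by (intro parg_add_le_pi) auto
  moreover have "0 \<le> ?C" using parg_bounds by simp
  ultimately have "cos \<bar>\<theta>\<bar> < cos ?C \<longleftrightarrow> ?C < \<bar>\<theta>\<bar>"
    using \<theta> by (intro cos_mono_less_eq) auto
  then show ?thesis unfolding cosC using N(2) by (simp del: real_sqrt_mult)
qed

text \<open>
  Now \<open>(A\<^sup>2 + w) (B\<^sup>2 + w) = (\<bar>A B\<bar> + w)\<^sup>2 + w (\<bar>A\<bar> - \<bar>B\<bar>)\<^sup>2 \<le> (\<bar>A B\<bar> + w)\<^sup>2\<close>, so \<open>\<bar>A B\<bar> + w\<close>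
  dominates the cosine term and only the sign of \<open>A B\<close> matters. The sum of the arguments is \<open>0\<close>
  or \<open>\<pi>\<close> accordingly, and the strict bounds on \<open>\<theta>\<close> keep \<open>\<bar>\<theta>\<bar>\<close> away from both values.
\<close>

lemma sector_iff_nonpositive:
  assumes AB: "0 < A + B" and w: "w \<le> 0" "0 < A\<^sup>2 + w" "0 < B\<^sup>2 + w"
    and \<theta>: "0 < \<bar>\<theta>\<bar>" "\<bar>\<theta>\<bar> < pi"
  shows "sqrt ((A\<^sup>2 + w) * (B\<^sup>2 + w)) * cos \<theta> < A * B - w
    \<longleftrightarrow> parg A 0 + parg B 0 < \<bar>\<theta>\<bar>"
proof -
  let ?P = "(A\<^sup>2 + w) * (B\<^sup>2 + w)"
  have P: "0 < sqrt ?P" using w by simp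
  have AB0: "A \<noteq> 0" "B \<noteq> 0" using w by auto
  have "w\<^sup>2 \<le> (A * B)\<^sup>2"
    using mult_mono[of "- w" "A\<^sup>2" "- w" "B\<^sup>2"] w by (simp add: power2_eq_square mult_ac)
  then have W: "- w \<le> \<bar>A * B\<bar>" using w abs_le_square_iff[of w "A * B"] by auto
  have "?P = (\<bar>A * B\<bar> + w)\<^sup>2 + w * (\<bar>A\<bar> - \<bar>B\<bar>)\<^sup>2"
    by (simp add: power2_eq_square algebra_simps abs_mult)
  moreover have "w * (\<bar>A\<bar> - \<bar>B\<bar>)\<^sup>2 \<le> 0" using w by (simp add: mult_nonpos_nonneg)
  ultimately have "?P \<le> (\<bar>A * B\<bar> + w)\<^sup>2" by linarith
  then have le: "sqrt ?P \<le> \<bar>A * B\<bar> + w" using W by (intro real_le_lsqrt) auto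
  show ?thesis
  proof (cases "0 < A \<and> 0 < B")
    case True
    have "cos \<theta> < 1"
      using cos_mono_less_eq[of "\<bar>\<theta>\<bar>" 0] \<theta> by simp
    then have "sqrt ?P * cos \<theta> < sqrt ?P * 1" using P by (intro mult_strict_left_mono)
    also have "\<dots> \<le> A * B - w" using le True w by simp
    finally show ?thesis using True \<theta> by (simp add: parg_pos_zero)
  next
    case False
    then have sgn: "A * B < 0" using AB AB0 by (auto simp: mult_less_0_iff)
    have "sqrt ?P * (- 1) \<le> sqrt ?P * cos \<theta>" using P by (intro mult_left_mono) auto
    then have "A * B - w \<le> sqrt ?P * cos \<theta>" using le sgn by simp
    moreover have "parg A 0 + parg B 0 = pi"
      using sgn by (auto simp: mult_less_0_iff parg_pos_zero parg_neg_zero)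
    ultimately show ?thesis using \<theta> by simp
  qed
qed

lemma sector_iff:
  assumes "0 < A + B" "0 < A\<^sup>2 + w" "0 < B\<^sup>2 + w" "0 < \<bar>\<theta>\<bar>" "\<bar>\<theta>\<bar> < pi"
  shows "sqrt ((A\<^sup>2 + w) * (B\<^sup>2 + w)) * cos \<theta> < A * B - w
    \<longleftrightarrow> parg A (sqrt (max 0 w)) + parg B (sqrt (max 0 w)) < \<bar>\<theta>\<bar>"
  using sector_iff_positive[of A B w \<theta>] sector_iff_nonpositive[of A B w \<theta>] assms
  by (cases "0 < w") auto

section \<open>The measure of a region between two graphs\<close>

lemma measurable_vec2:
  "(\<lambda>(x, y). vector [x, y] :: real^2) \<in> borel_measurable (lborel \<Otimes>\<^sub>M lborel)"
proof -
  have v: "(\<lambda>(x, y). vector [x, y] :: real^2) = (\<lambda>z. fst z *\<^sub>R axis 1 1 + snd z *\<^sub>R axis 2 1)"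
    by (auto simp: fun_eq_iff vec_eq_iff forall_2 axis_def)
  have "(\<lambda>(x, y). vector [x, y] :: real^2) \<in> borel_measurable borel"
    unfolding v by (intro borel_measurable_continuous_onI continuous_intros)
  then show ?thesis by (simp add: lborel_prod)
qed

text \<open>Makes Fubini's theorem on the product of two lines available for plane vectors.\<close>

lemma lborel_vec2:
  "(lborel :: (real^2) measure) = distr (lborel \<Otimes>\<^sub>M lborel) borel (\<lambda>(x, y). vector [x, y])"
proof (rule lborel_eqI)
  have Basis: "(Basis :: (real^2) set) = {axis 1 1, axis 2 1}"
    by (auto simp: Basis_vec_def UNIV_2)
  fix l u :: "real^2" assume le: "\<And>b. b \<in> Basis \<Longrightarrow> l \<bullet> b \<le> u \<bullet> b"
  then have le': "l $ 1 \<le> u $ 1" "l $ 2 \<le> u $ 2" using le[of "axis 1 1"] le[of "axis 2 1"]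
    by (simp_all add: Basis inner_axis)
  have "emeasure (distr (lborel \<Otimes>\<^sub>M lborel) borel (\<lambda>(x, y). vector [x, y])) (box l u)
    = emeasure (lborel \<Otimes>\<^sub>M lborel) ((\<lambda>(x, y). vector [x, y]) -` box l u \<inter> space (lborel \<Otimes>\<^sub>M lborel))"
    by (rule emeasure_distr[OF measurable_vec2]) simp
  also have "(\<lambda>(x, y). vector [x, y]) -` box l u \<inter> space (lborel \<Otimes>\<^sub>M lborel)
      = {l $ 1 <..< u $ 1} \<times> {l $ 2 <..< u $ 2}"
    by (auto simp: mem_box_cart forall_2 space_pair_measure)
  also have "emeasure (lborel \<Otimes>\<^sub>M lborel) \<dots> = ennreal ((u $ 1 - l $ 1) * (u $ 2 - l $ 2))"
    using le' by (simp add: lborel.emeasure_pair_measure_Times ennreal_mult)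
  also have "(u $ 1 - l $ 1) * (u $ 2 - l $ 2) = (\<Prod>b\<in>Basis. (u - l) \<bullet> b)"
    by (simp add: Basis inner_axis axis_eq_axis inner_diff_left)
  finally show "emeasure (distr (lborel \<Otimes>\<^sub>M lborel) borel (\<lambda>(x, y). vector [x, y])) (box l u)
    = (\<Prod>b\<in>Basis. (u - l) \<bullet> b)" .
qed simp

lemma emeasure_two_sided_interval:
  fixes c d :: real
  assumes "0 \<le> c" "c \<le> d"
  shows "emeasure lborel {x. c < \<bar>x\<bar> \<and> \<bar>x\<bar> < d} = ennreal (2 * (d - c))"
proof -
  have "{x. c < \<bar>x\<bar> \<and> \<bar>x\<bar> < d} = {c<..<d} \<union> {- d<..<- c}"
    using assms by auto
  moreover have "emeasure lborel ({c<..<d} \<union> {- d<..<- c}) = emeasure lborel {c<..<d} + emeasure lborel {- d<..<- c}"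
    using assms by (intro plus_emeasure[symmetric]) auto
  ultimately show ?thesis using assms by (simp flip: ennreal_plus)
qed

lemma emeasure_between_graph:
  fixes C :: "real \<Rightarrow> real"
  assumes C: "continuous_on UNIV C" and bounds: "\<And>x. 0 \<le> C x" "\<And>x. C x \<le> d"
    and I: "(C has_integral I) {a..b}" and ab: "a \<le> b"
  defines "E \<equiv> {x :: real^2. a < x $ 1 \<and> x $ 1 < b \<and> C (x $ 1) < \<bar>x $ 2\<bar> \<and> \<bar>x $ 2\<bar> < d}"
  shows "open E" and "emeasure lborel E = ennreal (2 * (d * (b - a) - I))"
proof -
  have "continuous_on UNIV (\<lambda>x :: real^2. C (x $ 1))"
    by (intro continuous_on_compose2[OF C] continuous_intros) auto
  then show E: "open E"
    unfolding E_def by (intro open_Collect_conj open_Collect_less continuous_intros) auto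
  let ?v = "\<lambda>(x, y). vector [x, y] :: real^2"
  note meas = measurable_vec2
  have Eb: "E \<in> sets borel" using E by simp
  have "emeasure lborel E = emeasure (lborel \<Otimes>\<^sub>M lborel) (?v -` E \<inter> space (lborel \<Otimes>\<^sub>M lborel))"
    by (subst lborel_vec2, rule emeasure_distr[OF meas Eb])
  also have "\<dots> = (\<integral>\<^sup>+x. emeasure lborel (Pair x -` (?v -` E \<inter> space (lborel \<Otimes>\<^sub>M lborel))) \<partial>lborel)"
    by (rule lborel.emeasure_pair_measure_alt[OF measurable_sets[OF meas Eb]])
  also have "\<dots> = (\<integral>\<^sup>+x. ennreal (2 * (d - C x)) * indicator {a<..<b} x \<partial>lborel)"
  proof (rule nn_integral_cong)
    fix x
    have "Pair x -` (?v -` E \<inter> space (lborel \<Otimes>\<^sub>M lborel))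
        = (if a < x \<and> x < b then {y. C x < \<bar>y\<bar> \<and> \<bar>y\<bar> < d} else {})"
      by (auto simp: E_def space_pair_measure)
    then show "emeasure lborel (Pair x -` (?v -` E \<inter> space (lborel \<Otimes>\<^sub>M lborel)))
        = ennreal (2 * (d - C x)) * indicator {a<..<b} x"
      using emeasure_two_sided_interval[OF bounds] by (auto simp: indicator_def)
  qed
  also have "\<dots> = ennreal (2 * (d * (b - a) - I))"
  proof (rule nn_integral_has_integral_lebesgue')
    have "((\<lambda>x. 2 * (d - C x)) has_integral 2 * (d * (b - a) - I)) {a..b}"
      using has_integral_mult_right[OF has_integral_diff[OF has_integral_const_real[of d a b] I], of 2] ab
      by (simp add: mult.commute)
    then show "((\<lambda>x. 2 * (d - C x)) has_integral 2 * (d * (b - a) - I)) {a<..<b}"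
      by (simp add: has_integral_Icc_iff_Ioo)
  qed (use bounds in simp)
  finally show "emeasure lborel E = ennreal (2 * (d * (b - a) - I))" .
qed

section \<open>The region of negative energy\<close>

text \<open>The last assumption says \<open>r\<^sub>A\<^sup>2 > 0\<close>; for \<open>R = R2 / R1\<close> all three hold when \<open>t\<^sup>- < t < t\<^sup>+\<close>.\<close>

locale cam_focus_focus = cam_params +
  fixes t :: real
  assumes t_pos: "0 < t" and t_less_1: "t < 1"
    and discriminant: "0 < - R\<^sup>2 * (1 - 2 * t)\<^sup>2 + 2 * R * t - t\<^sup>2"
begin

definition disc :: real where "disc = - R\<^sup>2 * (1 - 2 * t)\<^sup>2 + 2 * R * t - t\<^sup>2"
text \<open>
  The constants \<open>A\<close>, \<open>B\<close> and \<open>K\<close> are chosen such that \<open>disc - K s\<close> exceeds \<open>- A\<^sup>2\<close> and \<open>- B\<^sup>2\<close> by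
  \<open>K (2 R - s)\<close> and \<open>K (2 - s)\<close>: after scaling by \<open>K\<close>, the factors under the root in the energy
  are the squared moduli of \<open>A + i x\<close> and \<open>B + i x\<close> with \<open>x\<^sup>2 = disc - K s\<close>.
\<close>

definition A :: real where "A = R - t"
definition B :: real where "B = R + t - 2 * R * t"
definition K :: real where "K = 2 * R * t * (1 - t)"

lemma disc_pos: "0 < disc" using discriminant by (simp add: disc_def)

lemma r_A_eq: "r_A R t = sqrt disc" by (simp add: r_A_def disc_def)

lemma K_pos: "0 < K" using R t_pos t_less_1 by (simp add: K_def)

lemma A_B_sum: "A + B = K / t" "0 < A + B"
  using R t_pos t_less_1 by (simp_all add: A_def B_def K_def field_simps)

lemma A_square: "A\<^sup>2 + (disc - K * s) = K * (2 * R - s)"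
  by (simp add: A_def disc_def K_def power2_eq_square algebra_simps)

lemma B_square: "B\<^sup>2 + (disc - K * s) = K * (2 - s)"
  by (simp add: B_def disc_def K_def power2_eq_square algebra_simps)

lemma A_B_product: "t * (A * B - (disc - K * s)) = K * (t * s + R - 2 * R * t - t)"
  by (simp add: A_def B_def disc_def K_def power2_eq_square algebra_simps)

text \<open>
  Half of the opening angle of the arc \<open>H \<ge> 0\<close> on the circle of depth \<open>s\<close>. Truncation at \<open>0\<close> covers the
  depths for which this arc is empty or the whole circle.
\<close>

definition half_gap :: "real \<Rightarrow> real" where
  "half_gap s = parg A (sqrt (max 0 (disc - K * s))) + parg B (sqrt (max 0 (disc - K * s)))"

text \<open>
  Polar coordinates with the squared radius as the first variable, so that the Jacobian is the
  constant \<open>1 / 2\<close>.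
\<close>

definition polar :: "real^2 \<Rightarrow> real^2" where
  "polar x = vector [sqrt (x $ 1) * cos (x $ 2), sqrt (x $ 1) * sin (x $ 2)]"

lemma polar_radius:
  assumes "0 \<le> x $ 1"
  shows "(polar x $ 1)\<^sup>2 + (polar x $ 2)\<^sup>2 = x $ 1"
  using assms by (simp add: polar_def power_mult_distrib distrib_left[symmetric])

text \<open>
  Division of the energy by the positive factor \<open>s t / (R K)\<close> brings it to the form \<open>\<surd>((A\<^sup>2 + w) (B\<^sup>2 + w)) cos \<theta> - (A B - w)\<close>
  with \<open>w = disc - K s\<close>.
\<close>

lemma energy_polar_neg_iff:
  assumes s: "0 < x $ 1" "x $ 1 < 2 * half_depth" and \<theta>: "0 < \<bar>x $ 2\<bar>" "\<bar>x $ 2\<bar> < pi"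
  shows "energy t (polar x) < 0 \<longleftrightarrow> half_gap (x $ 1) < \<bar>x $ 2\<bar>"
proof -
  define s where "s = x $ 1"
  define \<theta> where "\<theta> = x $ 2"
  let ?w = "disc - K * s"
  let ?q = "sqrt ((2 - s) * (2 * R - s))"
  have pos: "0 < s" "0 < 2 - s" "0 < 2 * R - s" using s by (simp_all add: s_def half_depth_def)
  have w: "0 < A\<^sup>2 + ?w" "0 < B\<^sup>2 + ?w"
    unfolding A_square B_square using K_pos pos by simp_all
  have "(A\<^sup>2 + ?w) * (B\<^sup>2 + ?w) = K\<^sup>2 * ((2 - s) * (2 * R - s))"
    unfolding A_square B_square by (simp add: power2_eq_square)
  then have root: "sqrt ((A\<^sup>2 + ?w) * (B\<^sup>2 + ?w)) = K * ?q"
    using K_pos by (simp only: real_sqrt_mult real_sqrt_abs abs_of_pos)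
  have "sqrt (s * (2 - s) * (2 * R - s)) = sqrt s * ?q"
    by (simp only: real_sqrt_mult mult.assoc)
  then have "energy t (polar x)
      = s * (t / R - (1 - 2 * t) - t * s / R) + t * (sqrt s * cos \<theta>) * (sqrt s * ?q) / R"
    unfolding energy_def polar_radius[OF less_imp_le[OF s(1)]] Let_def s_def[symmetric]
    by (simp add: polar_def s_def \<theta>_def)
  also have "\<dots> = s * (t / R - (1 - 2 * t) - t * s / R) + t * (sqrt s * sqrt s) * (cos \<theta> * ?q) / R"
    by (simp only: mult_ac)
  also have "\<dots> = s / R * (t * (?q * cos \<theta>) - (t * s + R - 2 * R * t - t))"
    using pos R by (simp add: field_simps)
  finally have e: "energy t (polar x) = s / R * (t * (?q * cos \<theta>) - (t * s + R - 2 * R * t - t))" .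
  have "energy t (polar x) < 0 \<longleftrightarrow> t * (?q * cos \<theta>) < t * s + R - 2 * R * t - t"
    unfolding e using divide_pos_pos[OF pos(1) R] by (simp only: mult_less_0_iff) auto
  also have "\<dots> \<longleftrightarrow> K * (t * (?q * cos \<theta>)) < K * (t * s + R - 2 * R * t - t)"
    using K_pos by simp
  also have "\<dots> \<longleftrightarrow> t * (K * ?q * cos \<theta>) < t * (A * B - ?w)"
    unfolding A_B_product by (simp only: mult_ac)
  also have "\<dots> \<longleftrightarrow> sqrt ((A\<^sup>2 + ?w) * (B\<^sup>2 + ?w)) * cos \<theta> < A * B - ?w"
    unfolding root using t_pos by (simp add: mult.assoc)
  also have "\<dots> \<longleftrightarrow> half_gap s < \<bar>\<theta>\<bar>"
    unfolding half_gap_def using A_B_sum w \<theta> by (intro sector_iff) (auto simp: \<theta>_def)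
  finally show ?thesis by (simp add: s_def \<theta>_def)
qed

definition sector :: "(real^2) set" where
  "sector = {x. 0 < x $ 1 \<and> x $ 1 < 2 * half_depth \<and> half_gap (x $ 1) < \<bar>x $ 2\<bar> \<and> \<bar>x $ 2\<bar> < pi}"

lemma continuous_half_gap: "continuous_on S half_gap"
  unfolding half_gap_def by (intro continuous_intros)

lemma half_gap_nonneg: "0 \<le> half_gap s"
  using parg_bounds by (simp add: half_gap_def)

lemma half_gap_le_pi: "half_gap s \<le> pi"
  unfolding half_gap_def using A_B_sum(2) by (intro parg_add_le_pi) auto

text \<open>
  The sector leaves out the angles \<open>0\<close> and \<open>\<pi>\<close>, that is, the horizontal axis, which has measure zero.
\<close>

lemma polar_image_sector: "polar ` sector = {y \<in> sublevel t. y $ 2 \<noteq> 0}"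
proof (intro set_eqI iffI)
  fix y assume "y \<in> polar ` sector"
  then obtain x where y: "y = polar x" and x: "0 < x $ 1" "x $ 1 < 2 * half_depth"
    "half_gap (x $ 1) < \<bar>x $ 2\<bar>" "\<bar>x $ 2\<bar> < pi" by (auto simp: sector_def)
  have x2: "0 < \<bar>x $ 2\<bar>" using half_gap_nonneg[of "x $ 1"] x by linarith
  have "sin (x $ 2) \<noteq> 0"
    using sin_gt_zero[of "x $ 2"] sin_gt_zero[of "- (x $ 2)"] x x2 by (cases "0 < x $ 2") auto
  moreover have "polar x \<in> annulus" using x polar_radius[of x] by (simp add: annulus_def)
  ultimately show "y \<in> {y \<in> sublevel t. y $ 2 \<noteq> 0}"
    using energy_polar_neg_iff[OF x(1,2) x2 x(4)] x y by (simp add: sublevel_def) (simp add: polar_def)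
next
  fix y assume y: "y \<in> {y \<in> sublevel t. y $ 2 \<noteq> 0}"
  define s where "s = (y $ 1)\<^sup>2 + (y $ 2)\<^sup>2"
  have s: "0 < s" "s < 2 * half_depth" using y by (auto simp: sublevel_def annulus_def s_def)
  have "(y $ 1 / sqrt s)\<^sup>2 + (y $ 2 / sqrt s)\<^sup>2 = 1"
    using s by (simp add: power_divide add_divide_distrib[symmetric]) (simp add: s_def)
  then obtain a where a: "y $ 1 / sqrt s = cos a" "y $ 2 / sqrt s = sin a"
    using sincos_total_2pi by metis
  obtain b where b: "- pi < b" "b \<le> pi" "sin b = sin a" "cos b = cos a"
    using sincos_principal_value by metis
  define x :: "real^2" where "x = vector [s, b]"
  have x: "x $ 1 = s" "x $ 2 = b" by (simp_all add: x_def)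
  have "polar x = y"
    using a b s by (simp add: polar_def x vec_eq_iff forall_2) (simp add: field_simps)
  moreover have "sin b \<noteq> 0" using a b y s by auto
  then have "b \<noteq> 0" "b \<noteq> pi" by auto
  then have "0 < \<bar>x $ 2\<bar>" "\<bar>x $ 2\<bar> < pi" using b x by auto
  ultimately have "x \<in> sector"
    using energy_polar_neg_iff[of x] y s x by (auto simp: sector_def sublevel_def)
  with \<open>polar x = y\<close> show "y \<in> polar ` sector" by blast
qed

lemma inj_on_polar: "inj_on polar sector"
proof (rule inj_onI)
  fix x y assume x: "x \<in> sector" and y: "y \<in> sector" and eq: "polar x = polar y"
  have 1: "x $ 1 = y $ 1"
    using polar_radius[of x] polar_radius[of y] x y eq by (simp add: sector_def)
  have "polar x $ 1 = polar y $ 1" "polar x $ 2 = polar y $ 2" using eq by simp_all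
  then have "cos (x $ 2) = cos (y $ 2)" "sin (x $ 2) = sin (y $ 2)"
    using x by (auto simp: polar_def 1 sector_def)
  then obtain n :: int where n: "x $ 2 = y $ 2 + 2 * pi * n"
    using sin_cos_eq_iff by metis
  have "\<bar>x $ 2 - y $ 2\<bar> < 2 * pi" using x y by (auto simp: sector_def)
  then have "2 * pi * \<bar>real_of_int n\<bar> < 2 * pi * 1" unfolding n by (simp add: abs_mult)
  from mult_left_less_imp_less[OF this] have "\<bar>real_of_int n\<bar> < 1" by simp
  then have "n = 0" by linarith
  with n 1 show "x = y" by (simp add: vec_eq_iff forall_2)
qed

lemma polar_has_derivative:
  assumes "0 < x $ 1"
  shows "(polar has_derivative (\<lambda>v. vector
      [cos (x $ 2) / (2 * sqrt (x $ 1)) * v $ 1 - sqrt (x $ 1) * sin (x $ 2) * v $ 2,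
       sin (x $ 2) / (2 * sqrt (x $ 1)) * v $ 1 + sqrt (x $ 1) * cos (x $ 2) * v $ 2])) (at x)"
proof -
  note [derivative_intros] = bounded_linear_imp_has_derivative[OF bounded_linear_vec_nth]
  have r: "((\<lambda>x. sqrt (x $ 1)) has_derivative (\<lambda>v. v $ 1 * (inverse (sqrt (x $ 1)) / 2))) (at x)"
    by (rule DERIV_compose_FDERIV[where g="\<lambda>x::real^2. x $ 1" and x=x, OF DERIV_real_sqrt[OF assms]]) (intro derivative_intros)
  have c: "((\<lambda>x::real^2. cos (x $ 2)) has_derivative (\<lambda>v. v $ 2 * - sin (x $ 2))) (at x)"
    by (rule DERIV_compose_FDERIV[where g="\<lambda>x::real^2. x $ 2" and x=x, OF DERIV_cos]) (intro derivative_intros)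
  have s: "((\<lambda>x::real^2. sin (x $ 2)) has_derivative (\<lambda>v. v $ 2 * cos (x $ 2))) (at x)"
    by (rule DERIV_compose_FDERIV[where g="\<lambda>x::real^2. x $ 2" and x=x, OF DERIV_sin]) (intro derivative_intros)
  show ?thesis
    unfolding polar_def
    by (intro has_derivative_vector_2 has_derivative_eq_rhs[OF has_derivative_mult[OF r c]]
        has_derivative_eq_rhs[OF has_derivative_mult[OF r s]])
       (simp_all add: fun_eq_iff inverse_eq_divide algebra_simps)
qed

lemma measure_sublevel:
  assumes I: "(half_gap has_integral I) {0..2 * half_depth}"
  shows "measure lebesgue (sublevel t) = 2 * pi * half_depth - I"
proof -
  have half_depth: "0 < half_depth" using R by (simp add: half_depth_def)
  have open_sector: "open sector"
    and area: "emeasure lborel sector = ennreal (2 * (pi * (2 * half_depth - 0) - I))"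
    unfolding sector_def
    using half_depth by (intro emeasure_between_graph[OF continuous_half_gap half_gap_nonneg half_gap_le_pi I]; simp)+
  let ?M = "measure lebesgue (polar ` sector)"
  have negl: "negligible {y :: real^2. y $ 2 = 0}"
    using negligible_standard_hyperplane_cart[of 2] by simp
  have sub: "(sublevel t - polar ` sector) \<union> (polar ` sector - sublevel t) \<subseteq> {y. y $ 2 = 0}"
    unfolding polar_image_sector by auto
  have image: "polar ` sector \<in> lmeasurable" and M: "?M = measure lebesgue (sublevel t)"
    using lmeasurable_negligible_symdiff[OF lmeasurable_sublevel negligible_subset[OF negl sub]]
      measure_negligible_symdiff[OF lmeasurable_sublevel negligible_subset[OF negl sub]]
    by auto
  define P where "P x = (\<lambda>v :: real^2. vector
      [cos (x $ 2) / (2 * sqrt (x $ 1)) * v $ 1 - sqrt (x $ 1) * sin (x $ 2) * v $ 2,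
       sin (x $ 2) / (2 * sqrt (x $ 1)) * v $ 1 + sqrt (x $ 1) * cos (x $ 2) * v $ 2] :: real^2)"
    for x :: "real^2"
  have det: "\<bar>det (matrix (P x))\<bar> = 1 / 2" if "x \<in> sector" for x
  proof -
    have r: "0 < sqrt (x $ 1)" using that by (simp add: sector_def)
    have "det (matrix (P x)) = ((cos (x $ 2))\<^sup>2 + (sin (x $ 2))\<^sup>2) / 2"
      unfolding det_matrix_2 P_def using r
      by (simp add: axis_def power2_eq_square field_simps del: sin_cos_squared_add sin_cos_squared_add2 sin_cos_squared_add3)
    then show ?thesis by simp
  qed
  have "(polar has_derivative P x) (at x within sector)" if "x \<in> sector" for x
    unfolding P_def
    by (rule has_derivative_at_withinI[OF polar_has_derivative]) (use that in \<open>simp add: sector_def\<close>)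
  from has_measure_differentiable_image[OF _ this inj_on_polar, of ?M] image open_sector
  have "((\<lambda>x. \<bar>det (matrix (P x))\<bar>) has_integral ?M) sector" by simp
  then have "((\<lambda>x. 1 / 2) has_integral ?M) sector"
    by (rule has_integral_eq[rotated]) (simp add: det)
  from has_integral_mult_right[OF this, of 2]
  have "((\<lambda>x. 1) has_integral 2 * ?M) sector" by simp
  from nn_integral_has_integral_lebesgue'[OF _ this]
  have "emeasure lborel sector = ennreal (2 * ?M)"
    using open_sector by simp
  with area have "ennreal (2 * (pi * (2 * half_depth) - I)) = ennreal (2 * ?M)" by simp
  \<comment> \<open>Both sides of the equation must be nonnegative before the embedding into the extended reals can be cancelled.\<close>
  moreover have "I \<le> 2 * half_depth * pi"
    using has_integral_le[OF I has_integral_const_real[of pi 0 "2 * half_depth"]] half_gap_le_pi half_depth by simp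
  ultimately have "2 * (pi * (2 * half_depth) - I) = 2 * ?M"
    by (subst (asm) ennreal_inj) (simp_all add: mult.commute)
  then show ?thesis by (simp add: M)
qed

section \<open>The integral of the opening angle\<close>

text \<open>The depth at which the arc \<open>H \<ge> 0\<close> becomes empty or the whole circle.\<close>

definition critical :: real where "critical = disc / K"

text \<open>Substitute \<open>x = \<surd>(disc - K s)\<close>, for which \<open>ds = - (2 x / K) dx\<close>.\<close>

lemma half_gap_integral_inner:
  "(half_gap has_integral (parg_primitive A (sqrt disc) + parg_primitive B (sqrt disc)
      - A\<^sup>2 * parg A 0 - B\<^sup>2 * parg B 0) / K) {0..critical}"
proof -
  let ?s = "\<lambda>x. sqrt (max 0 (disc - K * x))"
  define F where "F x = - (parg_primitive A (?s x) + parg_primitive B (?s x)) / K" for x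
  have "(half_gap has_integral (F critical - F 0)) {0..critical}"
  proof (rule fundamental_theorem_of_calculus_interior)
    show "0 \<le> critical" using disc_pos K_pos by (simp add: critical_def)
    show "continuous_on {0..critical} F"
      unfolding F_def using K_pos
      by (intro continuous_intros) auto
    fix x assume x: "x \<in> {0<..<critical}"
    define S where "S = sqrt (disc - K * x)"
    have pos: "0 < disc - K * x" using x K_pos by (simp add: critical_def field_simps)
    then have S: "0 < S" by (simp add: S_def)
    have d1: "((\<lambda>x. disc - K * x) has_real_derivative - K) (at x)"
      by (auto intro!: derivative_eq_intros)
    have d: "((\<lambda>x. sqrt (disc - K * x)) has_real_derivative inverse S / 2 * - K) (at x)"
      unfolding S_def by (rule DERIV_chain2[OF DERIV_real_sqrt[OF pos] d1])
    have p: "((\<lambda>x. parg_primitive c (sqrt (disc - K * x))) has_real_derivative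
        2 * S * parg c S * (inverse S / 2 * - K)) (at x)" for c
      by (rule DERIV_chain2[OF _ d]) (use parg_primitive_has_derivative[OF S] in \<open>simp add: S_def\<close>)
    have "((\<lambda>x. - (parg_primitive A (sqrt (disc - K * x)) + parg_primitive B (sqrt (disc - K * x))) / K)
        has_real_derivative - (2 * S * parg A S * (inverse S / 2 * - K) + 2 * S * parg B S * (inverse S / 2 * - K)) / K) (at x)"
      by (intro DERIV_cdivide DERIV_minus DERIV_add p)
    moreover have "- (2 * S * parg A S * (inverse S / 2 * - K) + 2 * S * parg B S * (inverse S / 2 * - K)) / K
        = half_gap x"
    proof -
      have "half_gap x = parg A S + parg B S" using pos by (simp add: half_gap_def S_def)
      then show ?thesis using S K_pos by (simp add: field_simps)
    qed
    ultimately have "((\<lambda>x. - (parg_primitive A (sqrt (disc - K * x)) + parg_primitive B (sqrt (disc - K * x))) / K)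
        has_real_derivative half_gap x) (at x)" by simp
    then have "(F has_real_derivative half_gap x) (at x)"
    proof (rule has_field_derivative_transform_within_open[where S = "{0<..<critical}"])
      fix y assume "y \<in> {0<..<critical}"
      then have "0 < disc - K * y" using K_pos by (simp add: critical_def field_simps)
      then show "- (parg_primitive A (sqrt (disc - K * y)) + parg_primitive B (sqrt (disc - K * y))) / K = F y"
        by (simp add: F_def)
    qed (use x in auto)
    then show "(F has_vector_derivative half_gap x) (at x)"
      by (simp add: has_real_derivative_iff_has_vector_derivative)
  qed
  moreover have "F critical - F 0 = (parg_primitive A (sqrt disc) + parg_primitive B (sqrt disc)
      - A\<^sup>2 * parg A 0 - B\<^sup>2 * parg B 0) / K"
    using disc_pos K_pos by (simp add: F_def critical_def parg_primitive_def field_simps)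
  ultimately show ?thesis by simp
qed

lemma critical_le: "critical \<le> 2 * half_depth"
proof -
  have "0 \<le> K * (2 * R - critical)" "0 \<le> K * (2 - critical)"
    unfolding A_square[symmetric] B_square[symmetric] using K_pos by (simp_all add: critical_def)
  then show ?thesis using K_pos by (simp add: half_depth_def zero_le_mult_iff)
qed

lemma half_gap_integral_outer:
  "(half_gap has_integral (2 * half_depth - critical) * (parg A 0 + parg B 0)) {critical..2 * half_depth}"
proof (rule has_integral_eq)
  show "((\<lambda>_. parg A 0 + parg B 0) has_integral (2 * half_depth - critical) * (parg A 0 + parg B 0)) {critical..2 * half_depth}"
    using has_integral_const_real[of "parg A 0 + parg B 0" critical "2 * half_depth"] critical_le by simp
  fix x assume "x \<in> {critical..2 * half_depth}"
  then have "disc - K * x \<le> 0" using K_pos by (simp add: critical_def field_simps)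
  then show "parg A 0 + parg B 0 = half_gap x" by (simp add: half_gap_def)
qed

text \<open>
  At most one of \<open>A\<close> and \<open>B\<close> is not positive. If it is \<open>A\<close>, then \<open>R \<le> t < 1\<close> and the depth ends at \<open>2 R\<close>; if it is
  \<open>B\<close>, then \<open>R > 1\<close> and the depth ends at \<open>2\<close>. Either way its square is \<open>K\<close> times the remaining
  depth, which is also why the undetermined argument at \<open>A = 0\<close> or \<open>B = 0\<close> is harmless.
\<close>

lemma boundary_terms_cancel:
  "(2 * half_depth - critical) * (parg A 0 + parg B 0) = (A\<^sup>2 * parg A 0 + B\<^sup>2 * parg B 0) / K"
proof -
  have A2: "A\<^sup>2 = K * (2 * R - critical)" and B2: "B\<^sup>2 = K * (2 - critical)"
    using A_square[of critical] B_square[of critical] K_pos by (simp_all add: critical_def)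
  consider "A \<le> 0" | "B \<le> 0" | "0 < A" "0 < B" by linarith
  then show ?thesis
  proof cases
    case 1
    then have B: "0 < B" using A_B_sum by simp
    have "half_depth = R" using 1 t_less_1 by (simp add: A_def half_depth_def)
    then have "A\<^sup>2 = (2 * half_depth - critical) * K" using A2 by simp
    then show ?thesis using B K_pos by (simp add: parg_pos_zero)
  next
    case 2
    then have A: "0 < A" using A_B_sum by simp
    \<comment> \<open>\<open>B \<le> 0\<close>, rearranged to give \<open>t (1 - R) < 0\<close>, that is \<open>R > 1\<close>.\<close>
    have "t * (1 - R) \<le> R * (t - 1)" using 2 by (simp add: B_def algebra_simps)
    also have "\<dots> < 0" using R t_less_1 by (simp add: mult_pos_neg)
    finally have "half_depth = 1" using t_pos by (auto simp: half_depth_def mult_less_0_iff)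
    then have "B\<^sup>2 = (2 * half_depth - critical) * K" using B2 by simp
    then show ?thesis using A K_pos by (simp add: parg_pos_zero)
  qed (simp add: parg_pos_zero)
qed

text \<open>
  At depth \<open>0\<close> the squared moduli \<open>A\<^sup>2 + disc\<close> and \<open>B\<^sup>2 + disc\<close> are \<open>2 R K\<close> and \<open>2 K\<close>, whence the
  coefficients of the two arguments.
\<close>

lemma half_gap_integral:
  "(half_gap has_integral 2 * R * parg A (sqrt disc) + 2 * parg B (sqrt disc) - sqrt disc / t) {0..2 * half_depth}"
proof -
  have "A\<^sup>2 + (sqrt disc)\<^sup>2 = 2 * R * K" "B\<^sup>2 + (sqrt disc)\<^sup>2 = 2 * K"
    using A_square[of 0] B_square[of 0] disc_pos by simp_all
  then have "parg_primitive A (sqrt disc) + parg_primitive B (sqrt disc)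
      = K * (2 * R * parg A (sqrt disc) + 2 * parg B (sqrt disc)) - (A + B) * sqrt disc"
    unfolding parg_primitive_def by (simp only:) (simp add: algebra_simps)
  also have "\<dots> = K * (2 * R * parg A (sqrt disc) + 2 * parg B (sqrt disc) - sqrt disc / t)"
    unfolding A_B_sum(1) using t_pos by (simp add: field_simps)
  finally have "(parg_primitive A (sqrt disc) + parg_primitive B (sqrt disc)) / K
      = 2 * R * parg A (sqrt disc) + 2 * parg B (sqrt disc) - sqrt disc / t"
    using K_pos by simp
  then have "(parg_primitive A (sqrt disc) + parg_primitive B (sqrt disc)
      - A\<^sup>2 * parg A 0 - B\<^sup>2 * parg B 0) / K + (2 * half_depth - critical) * (parg A 0 + parg B 0)
      = 2 * R * parg A (sqrt disc) + 2 * parg B (sqrt disc) - sqrt disc / t"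
    unfolding boundary_terms_cancel by (simp add: diff_divide_distrib add_divide_distrib)
  moreover have "0 \<le> critical" using disc_pos K_pos by (simp add: critical_def)
  ultimately show ?thesis
    using has_integral_combine[OF _ critical_le half_gap_integral_inner half_gap_integral_outer] by simp
qed

lemma cam_ff_values: "L cam_ff = 0" "cam_H t cam_ff = 0"
  by (simp_all add: cam_L_def cam_H_def cam_ff_def)

section \<open>The height invariant\<close>

lemma height_invariant_eq:
  "height_invariant w L (cam_H t) cam_ff =
    2 * min R1 R2 + R1 / (pi * t) *
      (r_A R t - 2 * R * t * arctan_quot (r_A R t) (R - t)
               - 2 * t * arctan_quot (r_A R t) (R + t - 2 * R * t))"
proof -
  let ?I = "2 * R * parg A (sqrt disc) + 2 * parg B (sqrt disc) - sqrt disc / t"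
  have "0 \<le> 2 * R1 * measure lebesgue (sublevel t)" using R1 by simp
  then have "height_invariant w L (cam_H t) cam_ff = 2 * R1 * measure lebesgue (sublevel t) / (2 * pi)"
    unfolding height_invariant_def cam_ff_values reduced_area_eq by simp
  also have "\<dots> = 2 * (R1 * half_depth) - R1 * ?I / pi"
    unfolding measure_sublevel[OF half_gap_integral] by (simp add: field_simps)
  also have "R1 * half_depth = min R1 R2"
    using R1 by (simp add: half_depth_def R_def min_def field_simps)
  also have "2 * min R1 R2 - R1 * ?I / pi = 2 * min R1 R2 + R1 / (pi * t) *
      (sqrt disc - 2 * R * t * parg A (sqrt disc) - 2 * t * parg B (sqrt disc))"
    using t_pos by (simp add: field_simps)
  finally show ?thesis
    using disc_pos by (simp add: r_A_eq arctan_quot_eq_parg A_def B_def)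
qed

end

text \<open>
  The bounds on \<open>t\<close> are the roots of \<open>r\<^sub>A\<^sup>2 = 4 R t\<^sup>2 - (R - 2 R t - t)\<^sup>2\<close> as a polynomial in \<open>t\<close>, and the upper bound is at
  most \<open>1\<close> since \<open>2 R + 1 - 2 \<surd>R = R + (1 - \<surd>R)\<^sup>2\<close>.
\<close>

theorem theoremC:
  fixes R1 R2 R t :: real
  assumes "R1 > 0" and "R2 > 0"
    and "R = R2 / R1"
    and "t_minus R1 R2 < t" and "t < t_plus R1 R2"
  shows "height_invariant (cam_form R1 R2) (cam_L R1 R2) (cam_H t) cam_ff =
    2 * min R1 R2 + R1 / (pi * t) *
      (r_A R t - 2 * R * t * arctan_quot (r_A R t) (R - t)
               - 2 * t * arctan_quot (r_A R t) (R + t - 2 * R * t))"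
proof -
  interpret cam_params R1 R2 by unfold_locales (rule assms)+
  have Req: "cam_params.R R1 R2 = R" by (simp add: R_def assms(3))
  define k where "k = sqrt R"
  have Rpos: "0 < R" using assms by simp
  then have k: "0 < k" "k\<^sup>2 = R" by (simp_all add: k_def)
  have "R1 * R2 = R1\<^sup>2 * R" using assms by (simp add: power2_eq_square)
  then have "sqrt (R1 * R2) = sqrt (R1\<^sup>2) * k" by (simp only: real_sqrt_mult k_def)
  then have root: "sqrt (R1 * R2) = R1 * k" using assms(1) by simp
  have R2: "R2 = R1 * R" using assms by simp
  have dens: "2 * R2 + R1 - 2 * sqrt (R1 * R2) = R1 * (2 * R + 1 - 2 * k)"
    "2 * R2 + R1 + 2 * sqrt (R1 * R2) = R1 * (2 * R + 1 + 2 * k)"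
    unfolding root unfolding R2 by (simp_all add: algebra_simps)
  have "2 * R + 1 - 2 * k = R + (1 - k)\<^sup>2" using k by (simp add: power2_eq_square algebra_simps)
  then have d_pos: "R \<le> 2 * R + 1 - 2 * k" "0 < 2 * R + 1 - 2 * k" "0 < 2 * R + 1 + 2 * k"
    using Rpos k zero_le_power2[of "1 - k"] by linarith+
  have tm: "R / (2 * R + 1 + 2 * k) < t" and tp: "t < R / (2 * R + 1 - 2 * k)"
    using assms(1,4,5) unfolding t_minus_def t_plus_def dens by (simp_all add: R2)
  have "0 < R / (2 * R + 1 + 2 * k)" using Rpos d_pos by simp
  then have t0: "0 < t" using tm by simp
  have "R / (2 * R + 1 - 2 * k) \<le> 1" using d_pos by simp
  then have t1: "t < 1" using tp by simp
  have "R < t * (2 * R + 1 + 2 * k)" "t * (2 * R + 1 - 2 * k) < R"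
    using tm tp d_pos by (simp_all add: field_simps)
  then have "\<bar>R - 2 * R * t - t\<bar> < \<bar>2 * k * t\<bar>" using k t0 by (simp add: algebra_simps abs_less_iff)
  then have "(R - 2 * R * t - t)\<^sup>2 < (2 * k * t)\<^sup>2" by (metis abs_le_square_iff not_le)
  then have "0 < 4 * R * t\<^sup>2 - (R - 2 * R * t - t)\<^sup>2" using k by (simp add: power_mult_distrib)
  then have disc: "0 < - R\<^sup>2 * (1 - 2 * t)\<^sup>2 + 2 * R * t - t\<^sup>2"
    by (simp add: power2_eq_square algebra_simps)
  interpret cam_focus_focus R1 R2 t
    by unfold_locales (use t0 t1 disc in \<open>simp_all add: Req\<close>)
  show ?thesis using height_invariant_eq unfolding Req .
qed

end
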